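(* Let $p\ge 3$ be real, $d\ge 2$, $\mu>0$ and $\theta\in(0,\frac12]$. There exist a compact convex $p$-uniformly convex set $\mathcal C\subset\mathbb R^d$, a smooth convex function $g:\mathcal C\to\mathbb R$ satisfying the $(\mu,\theta)$-Hölderian error bound, with minimizer $x^*=\arg\min_{x\in\mathcal C}g(x)$, and an initial point $x_0\in\mathcal C$ such that the Frank--Wolfe algorithm with exact line search on $\min_{x\in\mathcal C}g(x)$ started at $x_0$ generates iterates $(x_t)_{t\ge0}$ satisfying $$g(x_T)-g(x^* )\;\sim\;\mu^{-\frac1\theta}\left(\frac{p+1}{p}\right)^{\frac1\theta}\left(\frac{p}{4(p-1)}\right)^{\frac{p}{2\theta(p-1)}}T^{-\frac{p}{2\theta(p-1)}}\qquad\text{as }T\to\infty.$$ In particular, $g(x_T)-g(x^* )=\Omega\left(T^{-\frac{p}{2\theta(p-1)}}\right)$, i.e. there is a constant $c>0$ with $g(x_T)-g(x^* )\ge c\,T^{-\frac{p}{2\theta(p-1)}}$ for all $T\ge1$.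
   Context: $\|\cdot\|$ denotes the Euclidean norm on $\mathbb R^d$. The notation $a_T\sim b_T$ means $a_T/b_T\to1$ as $T\to\infty$. Uniformly convex set: let $\mathcal C\subset\mathbb R^d$ be closed and $\gamma_{\mathcal C}:\mathbb R_+\to\mathbb R_+$ nondecreasing. $\mathcal C$ is $\gamma_{\mathcal C}$-uniformly convex (with respect to $\|\cdot\|$) if for all $x,y\in\mathcal C$, all $\eta\in[0,1]$ and all $z\in\mathbb R^d$ with $\|z\|=1$, $\eta x+(1-\eta)y+\eta(1-\eta)\gamma_{\mathcal C}(\|x-y\|)z\in\mathcal C$. If there exist $\alpha>0$ and $q\ge2$ with $\gamma_{\mathcal C}(r)\ge\alpha r^q$ for all $r\ge0$, then $\mathcal C$ is called $q$-uniformly convex. A differentiable function $g$ is smooth on $\mathcal C$ if for some $L>0$, $g(x)\le g(y)+\langle\nabla g(y),x-y\rangle+\frac L2\|x-y\|^2$ for all $x,y\in\mathcal C$ (differentiability on $\mathcal C$ is understood as differentiability on an open neighbourhood of $\mathcal C$). Hölderian error bound: let $g$ be strictly convex on $\mathcal C$ and $x^*=\arg\min_{x\in\mathcal C}g(x)$. For $\mu>0$ and $\theta\in[0,\frac12]$, $g$ satisfies the $(\mu,\theta)$-Hölderian error bound if $\|x-x^*\|\le\mu\,(g(x)-g(x^* ))^\theta$ for all $x\in\mathcal C$. Frank--Wolfe with exact line search: from $x_0\in\mathcal C$, for $t=0,1,2,\dots$: choose $v_t\in\arg\min_{v\in\mathcal C}\langle\nabla g(x_t),v\rangle$; choose $\gamma_t\in\arg\min_{\gamma\in[0,1]}g(x_t+\gamma(v_t-x_t))$;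 set $x_{t+1}=x_t+\gamma_t(v_t-x_t)$. *)

theory Defs
  imports "HOL-Analysis.Analysis" "HOL-Library.Landau_Symbols"
begin

definition uniformly_convex_set :: "(real \<Rightarrow> real) \<Rightarrow> 'a::real_normed_vector set \<Rightarrow> bool" where
  "uniformly_convex_set \<gamma> C \<longleftrightarrow>
     closed C \<and> mono_on {0..} \<gamma> \<and> (\<forall>r\<ge>0. \<gamma> r \<ge> 0) \<and>
     (\<forall>x\<in>C. \<forall>y\<in>C. \<forall>\<eta>\<in>{0..1}. \<forall>z. norm z = 1 \<longrightarrow>
        \<eta> *\<^sub>R x + (1 - \<eta>) *\<^sub>R y + (\<eta> * (1 - \<eta>) * \<gamma> (norm (x - y))) *\<^sub>R z \<in> C)"

definition power_uniformly_convex_set :: "real \<Rightarrow> 'a::real_normed_vector set \<Rightarrow> bool" where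
  "power_uniformly_convex_set q C \<longleftrightarrow>
     q \<ge> 2 \<and> (\<exists>\<gamma> \<alpha>. uniformly_convex_set \<gamma> C \<and> \<alpha> > 0 \<and> (\<forall>r\<ge>0. \<gamma> r \<ge> \<alpha> * r powr q))"

text \<open>Only meaningful at points of differentiability, where it is characterised by
  \<open>gradient_eqI\<close> below.\<close>
definition gradient :: "('a::real_inner \<Rightarrow> real) \<Rightarrow> 'a \<Rightarrow> 'a" where
  "gradient g x = (THE D. GDERIV g x :> D)"

lemma gradient_eqI:
  assumes "GDERIV g x :> D"
  shows "gradient g x = D"
  unfolding gradient_def
proof (rule the_equality)
  show "GDERIV g x :> D" by (rule assms)
  fix D' assume "GDERIV g x :> D'"
  with assms have "(\<lambda>h. h \<bullet> D') = (\<lambda>h. h \<bullet> D)"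
    unfolding gderiv_def by (rule has_derivative_unique[rotated])
  then have "h \<bullet> D' = h \<bullet> D" for h by meson
  from this[of "D' - D"] have "(D' - D) \<bullet> (D' - D) = 0"
    by (simp add: inner_diff_right)
  then show "D' = D" by simp
qed

definition smooth_fun_on :: "'a::real_inner set \<Rightarrow> ('a \<Rightarrow> real) \<Rightarrow> bool" where
  "smooth_fun_on C g \<longleftrightarrow>
     (\<exists>U. open U \<and> C \<subseteq> U \<and> g differentiable_on U) \<and>
     (\<exists>L>0. \<forall>x\<in>C. \<forall>y\<in>C.
        g x \<le> g y + gradient g y \<bullet> (x - y) + L / 2 * (norm (x - y))\<^sup>2)"

definition strictly_convex_on :: "'a::real_vector set \<Rightarrow> ('a \<Rightarrow> real) \<Rightarrow> bool" where
  "strictly_convex_on C g \<longleftrightarrow> convex C \<and>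
     (\<forall>x\<in>C. \<forall>y\<in>C. \<forall>t. x \<noteq> y \<and> 0 < t \<and> t < 1 \<longrightarrow>
        g ((1 - t) *\<^sub>R x + t *\<^sub>R y) < (1 - t) * g x + t * g y)"

text \<open>Strict convexity of \<open>g\<close> is a standing assumption of the error bound.  For \<open>\<theta> = 0\<close> and
  \<open>x = xs\<close> the convention \<open>0 powr 0 = 0\<close> is harmless, as the left-hand side vanishes there.\<close>
definition hoelder_error_bound ::
    "real \<Rightarrow> real \<Rightarrow> 'a::real_normed_vector set \<Rightarrow> ('a \<Rightarrow> real) \<Rightarrow> 'a \<Rightarrow> bool" where
  "hoelder_error_bound \<mu> \<theta> C g xs \<longleftrightarrow>
     \<mu> > 0 \<and> \<theta> \<in> {0..1/2} \<and> strictly_convex_on C g \<and> is_arg_min g (\<lambda>x. x \<in> C) xs \<and>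
     (\<forall>x\<in>C. norm (x - xs) \<le> \<mu> * (g x - g xs) powr \<theta>)"

text \<open>Both minimisation steps may have several solutions; this predicate accepts every
  sequence produced by some choice of minimisers.\<close>
definition frank_wolfe_line_search ::
    "'a::real_inner set \<Rightarrow> ('a \<Rightarrow> real) \<Rightarrow> 'a \<Rightarrow> (nat \<Rightarrow> 'a) \<Rightarrow> bool" where
  "frank_wolfe_line_search C g x0 x \<longleftrightarrow>
     x 0 = x0 \<and>
     (\<forall>t. \<exists>v s. is_arg_min (\<lambda>v. gradient g (x t) \<bullet> v) (\<lambda>v. v \<in> C) v \<and>
                is_arg_min (\<lambda>s. g (x t + s *\<^sub>R (v - x t))) (\<lambda>s. s \<in> {0..1}) s \<and>
                x (Suc t) = x t + s *\<^sub>R (v - x t))"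

end

theory Submission
  imports Defs "HOL-Real_Asymp.Real_Asymp"
begin

text \<open>
  The objective is a power of the distance to \<open>0\<close>, scaled so that the error bound holds with equality,
  and \<open>0\<close> is a boundary point of the constraint set.  Exact line search then projects \<open>0\<close> onto the
  segment between the current iterate and the vertex returned by linear minimisation, and the problem
  is reduced to the geometry of the constraint set near \<open>0\<close>, which is chosen as
  \<open>{x. f (norm (horizontal part of x)) \<le> height of x}\<close>, intersected with the unit ball, where
  \<open>f u = u powr p / p + u powr (p + 1)\<close>.  The set is \<open>p\<close>-uniformly convex because the Euclidean norm to
  the power \<open>p\<close> is (lemma \<open>power_uniformly_convex_body\<close>).

  An iterate in the plane spanned by the axis \<open>e\<close> and a unit vector \<open>e'\<close> orthogonal to it is described by
  its height \<open>b\<close> and the absolute value \<open>s\<close> of the ratio of its coordinates.  The vertex lies on the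
  other side of the axis, at \<open>(u, f u)\<close> up to sign, where \<open>s\<close> is the slope \<open>f' u\<close> of the boundary.
  Projection of \<open>0\<close> onto the chord gives the next state (lemma \<open>frank_wolfe_step\<close>)
  \<open>s' = (b - f u) / (u + s * b)\<close> and \<open>b' = b * (1 - s * s') / (1 + s'\<^sup>2)\<close>.
  The iterates zigzag across the axis while \<open>b\<close> decreases slowly, and for nearly constant \<open>b\<close> the slopes
  are close to a fixed point \<open>f' w\<close> of the first recursion, given by \<open>b = f w + w * f' w\<close>.

  For \<open>f u = u powr p / p\<close> the multiplier of the first recursion at its fixed point is \<open>- 2 / (p - 1)\<close>.
  It is neutral for \<open>p = 3\<close>.  The summand \<open>u powr (p + 1)\<close> is negligible for the rate, but it adds a
  contraction of relative order \<open>w\<close>, stronger than the nonlinear terms on a window of relative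
  width \<open>w\<close> around the fixed point and than the drift of the window, of relative order at most
  \<open>w ^ 4\<close>.  So the window is a trap (lemma \<open>trap_step\<close>), and the freedom in the initial point is used to
  start in it.

  In the trap \<open>s\<close> is asymptotic to \<open>w powr (p - 1)\<close> and \<open>b\<close> to \<open>(p + 1) / p * w powr p\<close>, and the relative
  decrease of \<open>b\<close> in one step is asymptotic to \<open>2 * s\<^sup>2\<close>.  Hence the increments of the power
  \<open>- 2 * (p - 1) / p\<close> of \<open>b\<close> converge to an explicit limit, and averaging them gives the rate with its
  constant (lemma \<open>trapped_rate\<close>).
\<close>

section \<open>The boundary profile\<close>

text \<open>
  The term \<open>u powr p / p\<close> determines all constants of the rate.  The term of higher order makes the
  slopes of the iterates settle; without it they would be neutrally stable for \<open>p = 3\<close>.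
\<close>
definition profile :: "real \<Rightarrow> real \<Rightarrow> real" where
  "profile p u = u powr p / p + u powr (p + 1)"

definition slope :: "real \<Rightarrow> real \<Rightarrow> real" where
  "slope p u = u powr (p - 1) + (p + 1) * u powr p"

text \<open>
  The height \<open>b\<close> at which the slope \<open>slope p w\<close> reproduces itself: the line through the vertex
  \<open>(- w, profile p w)\<close> with slope \<open>slope p w\<close> meets the vertical axis at height \<open>level p w\<close>.
\<close>
definition level :: "real \<Rightarrow> real \<Rightarrow> real" where
  "level p w = profile p w + w * slope p w"

lemma profile_0 [simp]: "profile p 0 = 0"
  by (simp add: profile_def)

lemma profile_nonneg: "0 < p \<Longrightarrow> 0 \<le> profile p u"
  by (simp add: profile_def)

lemma slope_pos: "0 \<le> p \<Longrightarrow> 0 < u \<Longrightarrow> 0 < slope p u"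
  unfolding slope_def by (intro add_pos_nonneg) auto

lemma slope_nonneg: "0 \<le> p \<Longrightarrow> 0 \<le> slope p u"
  unfolding slope_def by (intro add_nonneg_nonneg mult_nonneg_nonneg) auto

lemma profile_mono: "\<lbrakk>0 < p; 0 \<le> u; u \<le> v\<rbrakk> \<Longrightarrow> profile p u \<le> profile p v"
  unfolding profile_def by (intro add_mono divide_right_mono powr_mono2) auto

lemma slope_mono: "\<lbrakk>1 \<le> p; 0 \<le> u; u \<le> v\<rbrakk> \<Longrightarrow> slope p u \<le> slope p v"
  unfolding slope_def by (intro add_mono mult_left_mono powr_mono2) auto

lemma slope_strict_mono: "\<lbrakk>1 < p; 0 \<le> u; u < v\<rbrakk> \<Longrightarrow> slope p u < slope p v"
  unfolding slope_def by (intro add_strict_mono mult_strict_left_mono powr_less_mono2) auto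

lemma continuous_on_profile: "0 < p \<Longrightarrow> continuous_on {0..} (profile p)"
  unfolding profile_def by (intro continuous_on_add continuous_on_divide continuous_on_powr' continuous_intros) auto

lemma continuous_on_slope: "1 < p \<Longrightarrow> continuous_on {0..} (slope p)"
  unfolding slope_def by (intro continuous_on_add continuous_on_mult continuous_on_powr' continuous_intros) auto

lemma continuous_on_level: "1 < p \<Longrightarrow> continuous_on {0..} (level p)"
  unfolding level_def
  by (intro continuous_on_add continuous_on_mult continuous_on_profile continuous_on_slope)
     (auto intro: continuous_on_id)

lemma has_real_derivative_profile:
  assumes "0 < p" "0 < u"
  shows "(profile p has_real_derivative slope p u) (at u)"
  unfolding profile_def slope_def
  by (rule derivative_eq_intros refl | (use assms in simp; fail))+

lemma profile_mvt:
  assumes p: "0 < p" and "0 \<le> c" "c < d"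
  obtains \<xi> where "c < \<xi>" "\<xi> < d" "profile p d - profile p c = slope p \<xi> * (d - c)"
proof -
  have "continuous_on {c..d} (profile p)"
    using continuous_on_subset[OF continuous_on_profile[OF p], of "{c..d}"] \<open>0 \<le> c\<close> by auto
  moreover have "(profile p has_derivative (\<lambda>h. slope p x * h)) (at x)" if "c < x" for x
    using has_real_derivative_profile[OF p, of x] that \<open>0 \<le> c\<close>
    by (simp add: has_field_derivative_def)
  ultimately show ?thesis
    using mvt[OF \<open>c < d\<close>, of "profile p" "\<lambda>x h. slope p x * h"] that by blast
qed

lemma profile_lipschitz:
  assumes p: "1 < p" and ab: "0 \<le> a" "0 \<le> b" "a \<le> R" "b \<le> R"
  shows "\<bar>profile p a - profile p b\<bar> \<le> slope p R * \<bar>a - b\<bar>"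
proof -
  have ordered: "\<bar>profile p d - profile p c\<bar> \<le> slope p R * \<bar>d - c\<bar>"
    if cd: "0 \<le> c" "c < d" "d \<le> R" for c d
  proof -
    obtain \<xi> where \<xi>: "c < \<xi>" "\<xi> < d" "profile p d - profile p c = slope p \<xi> * (d - c)"
      using profile_mvt[of p c d] p cd by auto
    moreover have "slope p \<xi> \<le> slope p R" using \<xi> cd p by (intro slope_mono) auto
    moreover have "0 \<le> slope p \<xi>" using p by (intro slope_nonneg) auto
    ultimately show ?thesis using cd by (simp add: abs_mult mult_right_mono)
  qed
  show ?thesis
    using ordered[of a b] ordered[of b a] ab
    by (cases a b rule: linorder_cases) (auto simp: abs_minus_commute)
qed

text \<open>
  Strictness is what makes the vertex returned by linear minimisation unique.
\<close>
lemma profile_strict_tangent: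
  assumes p: "1 < p" and u: "0 < u" and r: "0 \<le> r" "r \<noteq> u"
  shows "profile p u + slope p u * (r - u) < profile p r"
proof -
  consider "u < r" | "r < u" using r by linarith
  then show ?thesis
  proof cases
    case 1
    then obtain \<xi> where "u < \<xi>" "\<xi> < r" "profile p r - profile p u = slope p \<xi> * (r - u)"
      using profile_mvt[of p u r] u p by auto
    moreover have "slope p u * (r - u) < slope p \<xi> * (r - u)"
      using 1 \<open>u < \<xi>\<close> u p by (intro mult_strict_right_mono slope_strict_mono) auto
    ultimately show ?thesis by linarith
  next
    case 2
    then obtain \<xi> where \<xi>: "r < \<xi>" "\<xi> < u" "profile p u - profile p r = slope p \<xi> * (u - r)"
      using profile_mvt[of p r u] r p by auto
    moreover have "slope p \<xi> * (u - r) < slope p u * (u - r)"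
      using 2 \<xi> r p by (intro mult_strict_right_mono slope_strict_mono) auto
    moreover have "slope p u * (r - u) = - (slope p u * (u - r))" by (simp add: algebra_simps)
    ultimately show ?thesis by linarith
  qed
qed

lemma profile_scaled:
  "\<lbrakk>0 < w; 0 \<le> c\<rbrakk> \<Longrightarrow> profile p (w * c) = w powr p * (c powr p / p + w * c powr (p + 1))"
  by (simp add: profile_def powr_mult powr_add algebra_simps)

lemma slope_scaled:
  "\<lbrakk>0 < w; 0 \<le> c\<rbrakk> \<Longrightarrow>
     w * slope p (w * c) = w powr p * (c powr (p - 1) + (p + 1) * w * c powr p)"
  by (simp add: slope_def powr_mult powr_diff algebra_simps)

lemma level_eq:
  "\<lbrakk>0 < p; 0 < w\<rbrakk> \<Longrightarrow> level p w = w powr p * ((p + 1) / p + (p + 2) * w)"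
  using profile_scaled[of w 1 p] slope_scaled[of w 1 p]
  by (simp add: level_def field_simps)

lemma level_pos: "\<lbrakk>0 < p; 0 < w\<rbrakk> \<Longrightarrow> 0 < level p w"
  by (simp add: level_def add_nonneg_pos profile_nonneg slope_pos)

lemma level_shrink:
  assumes "1 \<le> p" "0 < w" "0 \<le> c" "c \<le> 1"
  shows "level p (w * c) \<le> c * level p w"
proof (cases "c = 0")
  case False
  then have c: "0 < c" using assms by simp
  have "level p (w * c) = w powr p * (c powr p * ((p + 1) / p + (p + 2) * (w * c)))"
    using assms c by (subst level_eq) (auto simp: powr_mult)
  also have "\<dots> \<le> w powr p * (c * ((p + 1) / p + (p + 2) * w))"
  proof (intro mult_left_mono mult_mono add_left_mono)
    show "c powr p \<le> c"
      using powr_mono'[of 1 p c] assms by simp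
    show "w * c \<le> w" using assms by (simp add: mult_left_le)
  qed (use assms in auto)
  also have "\<dots> = c * level p w"
    using assms by (subst level_eq) auto
  finally show ?thesis .
qed (simp add: level_def)

section \<open>The trap for the slopes\<close>

lemma eventually_le_of_deriv_pos:
  fixes f g :: "real \<Rightarrow> real"
  assumes "((\<lambda>w. g w - f w) has_real_derivative D) (at 0)" "0 < D" "g 0 = f 0"
  shows "\<forall>\<^sub>F w in at_right 0. f w \<le> g w"
proof -
  obtain \<delta> where "0 < \<delta>" "\<And>h. 0 < h \<Longrightarrow> h < \<delta> \<Longrightarrow> g 0 - f 0 < g h - f h"
    using has_real_derivative_pos_inc_right[OF assms(1,2)] by auto
  then show ?thesis
    unfolding eventually_at_right_field using assms(3) by (force intro!: exI[of _ \<delta>])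
qed

text \<open>
  After division by \<open>w powr p\<close> both sides depend on \<open>w\<close> only through powers of \<open>1 \<plusminus> w\<close>, and they
  agree at \<open>w = 0\<close>.  For \<open>p > 3\<close> the difference has derivative \<open>p - 3\<close> there.  For \<open>p = 3\<close> this
  first-order term vanishes, and the inequality holds because of the second-order term \<open>4 * w\<^sup>2\<close>,
  which comes entirely from the summand \<open>u powr (p + 1)\<close> of the profile.
\<close>
lemma lower_trap_eventually:
  assumes p: "p \<ge> 3"
  shows "\<forall>\<^sub>F w in at_right 0.
    w * (1 + w) * (1 + w ^ 3) * slope p (w * (1 - w)) \<le> level p w - profile p (w * (1 + w))"
proof -
  define lhs where "lhs = (\<lambda>w. (1 + w) * (1 + w ^ 3) * ((1 - w) powr (p - 1) + (p + 1) * w * (1 - w) powr p))"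
  define rhs where "rhs = (\<lambda>w. (p + 1) / p + (p + 2) * w - ((1 + w) powr p / p + w * (1 + w) powr (p + 1)))"
  have ev: "\<forall>\<^sub>F w in at_right 0. lhs w \<le> rhs w"
  proof (cases "p = 3")
    case True
    show ?thesis unfolding lhs_def rhs_def True by real_asymp
  next
    case False
    then have p3: "p > 3" using p by simp
    have "((\<lambda>w. rhs w - lhs w) has_real_derivative (p - 3)) (at 0)"
      unfolding lhs_def rhs_def
      by (rule derivative_eq_intros refl | (use p3 in simp; fail))+
    moreover have "rhs 0 = lhs 0" using p by (simp add: lhs_def rhs_def field_simps)
    ultimately show ?thesis
      using eventually_le_of_deriv_pos[of rhs lhs "p - 3"] p3 by simp
  qed
  have "\<forall>\<^sub>F w::real in at_right 0. 0 < w \<and> w < 1"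
    by (rule eventually_at_rightI[of 0 1]) auto
  with ev show ?thesis
  proof eventually_elim
    case (elim w)
    have "w * (1 + w) * (1 + w ^ 3) * slope p (w * (1 - w))
        = (1 + w) * (1 + w ^ 3) * (w * slope p (w * (1 - w)))" by simp
    also have "\<dots> = w powr p * lhs w"
      using elim by (subst slope_scaled) (auto simp: lhs_def)
    also have "\<dots> \<le> w powr p * rhs w"
      using elim by (intro mult_left_mono) auto
    also have "\<dots> = level p w - profile p (w * (1 + w))"
      using elim p by (subst profile_scaled, simp, simp, subst level_eq)
        (auto simp: rhs_def right_diff_distrib)
    finally show ?case .
  qed
qed

text \<open>
  The counterpart at the lower end of the window.  The height may have dropped by then, which
  shrinks the window from \<open>w\<close> to at least \<open>w * (1 - w ^ 3)\<close>; this is of higher order than the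
  margin, so the same expansion applies.
\<close>
lemma upper_trap_eventually:
  assumes p: "p \<ge> 3"
  shows "\<forall>\<^sub>F w in at_right 0.
    level p w - profile p (w * (1 - w))
      \<le> w * (1 - w) * slope p (w * ((1 - w ^ 3) * (1 + w * (1 - w ^ 3))))"
proof -
  define lhs where "lhs = (\<lambda>w. (p + 1) / p + (p + 2) * w - ((1 - w) powr p / p + w * (1 - w) powr (p + 1)))"
  define rhs where "rhs = (\<lambda>w. (1 - w) * (((1 - w ^ 3) * (1 + w * (1 - w ^ 3))) powr (p - 1)
      + (p + 1) * w * ((1 - w ^ 3) * (1 + w * (1 - w ^ 3))) powr p))"
  have ev: "\<forall>\<^sub>F w in at_right 0. lhs w \<le> rhs w"
  proof (cases "p = 3")
    case True
    show ?thesis unfolding lhs_def rhs_def True by real_asymp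
  next
    case False
    then have p3: "p > 3" using p by simp
    have "((\<lambda>w. rhs w - lhs w) has_real_derivative (p - 3)) (at 0)"
      unfolding lhs_def rhs_def
      by (rule derivative_eq_intros refl | (use p3 in simp; fail))+
    moreover have "rhs 0 = lhs 0" using p by (simp add: lhs_def rhs_def field_simps)
    ultimately show ?thesis
      using eventually_le_of_deriv_pos[of rhs lhs "p - 3"] p3 by simp
  qed
  have "\<forall>\<^sub>F w::real in at_right 0. 0 < w \<and> w < 1"
    by (rule eventually_at_rightI[of 0 1]) auto
  with ev show ?thesis
  proof eventually_elim
    case (elim w)
    have w3: "w ^ 3 \<le> 1" using elim by (simp add: power_le_one)
    have "level p w - profile p (w * (1 - w)) = w powr p * lhs w"
      using elim p by (subst profile_scaled, simp, simp, subst level_eq)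
        (auto simp: lhs_def right_diff_distrib)
    also have "\<dots> \<le> w powr p * rhs w"
      using elim by (intro mult_left_mono) auto
    also have "\<dots> = (1 - w) * (w * slope p (w * ((1 - w ^ 3) * (1 + w * (1 - w ^ 3)))))"
      using elim w3 by (subst slope_scaled) (auto simp: rhs_def)
    finally show ?case by (simp add: mult_ac)
  qed
qed

lemma small_steps_eventually:
  assumes p: "p \<ge> 3"
  shows "\<forall>\<^sub>F w in at_right 0. 2 * slope p (2 * w) ^ 2 \<le> w ^ 3"
    and "\<forall>\<^sub>F w in at_right 0. slope p (2 * w) * level p w \<le> w ^ 3 * (w / 2)"
    and "\<forall>\<^sub>F w in at_right 0. 2 * w + profile p (2 * w) + 2 * level p w \<le> 1"
    and "\<forall>\<^sub>F w::real in at_right 0. w \<le> 1 / 2"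
proof -
  show "\<forall>\<^sub>F w in at_right 0. 2 * slope p (2 * w) ^ 2 \<le> w ^ 3"
    using p unfolding slope_def by real_asymp
  show "\<forall>\<^sub>F w in at_right 0. slope p (2 * w) * level p w \<le> w ^ 3 * (w / 2)"
    using p unfolding slope_def level_def profile_def by real_asymp
  show "\<forall>\<^sub>F w in at_right 0. 2 * w + profile p (2 * w) + 2 * level p w \<le> 1"
    using p unfolding slope_def level_def profile_def by real_asymp
  show "\<forall>\<^sub>F w::real in at_right 0. w \<le> 1 / 2"
    by real_asymp
qed

text \<open>
  The first two conjuncts say that slopes at the upper end of the window below are sent above its
  lower end, and slopes at the lower end below its upper end.  The next two bound the drift of the
  height and the lever arm \<open>s * b\<close> of the current iterate, which the first two treat as
  perturbations of relative size \<open>w ^ 3\<close>.  The last two keep everything inside the unit ball.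
\<close>
definition trap_conditions :: "real \<Rightarrow> real \<Rightarrow> bool" where
  "trap_conditions p w \<longleftrightarrow>
     w * (1 + w) * (1 + w ^ 3) * slope p (w * (1 - w)) \<le> level p w - profile p (w * (1 + w)) \<and>
     level p w - profile p (w * (1 - w))
       \<le> w * (1 - w) * slope p (w * ((1 - w ^ 3) * (1 + w * (1 - w ^ 3)))) \<and>
     2 * slope p (2 * w) ^ 2 \<le> w ^ 3 \<and>
     slope p (2 * w) * level p w \<le> w ^ 3 * (w / 2) \<and>
     2 * w + profile p (2 * w) + 2 * level p w \<le> 1 \<and> w \<le> 1 / 2"

definition trap_range :: "real \<Rightarrow> real \<Rightarrow> bool" where
  "trap_range p w0 \<longleftrightarrow> 0 < w0 \<and> (\<forall>w. 0 < w \<and> w \<le> w0 \<longrightarrow> trap_conditions p w)"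

lemma trap_range_exists:
  assumes "p \<ge> 3"
  obtains w0 where "trap_range p w0"
proof -
  have "\<forall>\<^sub>F w in at_right 0. trap_conditions p w"
    unfolding trap_conditions_def
    by (intro eventually_conj lower_trap_eventually upper_trap_eventually
        small_steps_eventually[OF assms] assms)
  then obtain c where "c > 0" "\<And>w. 0 < w \<Longrightarrow> w < c \<Longrightarrow> trap_conditions p w"
    unfolding eventually_at_right_field by blast
  then have "trap_range p (c / 2)"
    unfolding trap_range_def by force
  then show ?thesis by (rule that)
qed

text \<open>
  The window of relative half-width \<open>w\<close> around the self-reproducing slope.  It is narrow enough for
  the slopes to be asymptotically determined by the height, and wide enough to absorb the downward
  drift of the window itself.
\<close>
definition trapped :: "real \<Rightarrow> real \<Rightarrow> real \<Rightarrow> real \<Rightarrow> bool" where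
  "trapped p w s b \<longleftrightarrow>
     b = level p w \<and> slope p (w * (1 - w)) \<le> s \<and> s \<le> slope p (w * (1 + w))"

text \<open>
  The new slope \<open>s'\<close> is a decreasing function of the vertex position \<open>u\<close>, hence it is controlled by
  its values at the two ends of the window.  The new height \<open>b'\<close> is the level of some \<open>w'\<close> slightly
  below \<open>w\<close>, by the intermediate value theorem.  The lower end of the window moves down with \<open>w'\<close>,
  so only its upper end has to be compared with the drift.
\<close>
lemma trap_step:
  assumes p: "p \<ge> 3" and range: "trap_range p w0" and w: "0 < w" "w \<le> w0"
    and trapped: "trapped p w s b"
    and u: "w * (1 - w) \<le> u" "u \<le> w * (1 + w)" "s = slope p u"
    and s': "s' = (b - profile p u) / (u + s * b)"
    and b': "b' = b * (1 - s * s') / (1 + s'\<^sup>2)"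
  shows "\<exists>w'. 0 < w' \<and> w' \<le> w \<and> trapped p w' s' b'"
proof -
  have b: "b = level p w" using trapped by (simp add: trapped_def)
  have lower: "w * (1 + w) * (1 + w ^ 3) * slope p (w * (1 - w)) \<le> b - profile p (w * (1 + w))"
    and upper: "b - profile p (w * (1 - w))
       \<le> w * (1 - w) * slope p (w * ((1 - w ^ 3) * (1 + w * (1 - w ^ 3))))"
    and drift: "2 * slope p (2 * w) ^ 2 \<le> w ^ 3"
    and lever: "slope p (2 * w) * b \<le> w ^ 3 * (w / 2)" and half: "w \<le> 1 / 2"
    using range w unfolding trap_range_def trap_conditions_def b by blast+
  define c where "c = 1 - w ^ 3"
  have w3: "w ^ 3 \<le> 1 / 2"
  proof -
    have "w ^ 3 \<le> (1 / 2) ^ 3" using w half by (intro power_mono) auto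
    then show ?thesis by (simp add: power3_eq_cube)
  qed
  have c: "1 / 2 \<le> c" "c < 1" using w w3 by (auto simp: c_def)
  have b0: "0 < b" using b level_pos p w by simp
  have wlo: "w / 2 \<le> w * (1 - w)" using w half by (simp add: field_simps)
  have whi: "w * (1 + w) \<le> 2 * w" using w half by (simp add: field_simps)
  have u0: "0 < u" "w / 2 \<le> u" "u \<le> 2 * w" using u wlo whi w by linarith+
  have s0: "0 < s" using u(3) slope_pos u0(1) p by simp
  have s2: "s \<le> slope p (2 * w)" using u(3) slope_mono[of p u "2 * w"] u0 p by simp
  have sb: "s * b \<le> w ^ 3 * u"
  proof -
    have "s * b \<le> slope p (2 * w) * b" using s2 b0 by simp
    also have "\<dots> \<le> w ^ 3 * (w / 2)" by (rule lever)
    also have "\<dots> \<le> w ^ 3 * u" using w u0 by (intro mult_left_mono) auto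
    finally show ?thesis .
  qed
  have numer_lo: "b - profile p (w * (1 + w)) \<le> b - profile p u"
    using profile_mono[of p u "w * (1 + w)"] u u0 p by simp
  have numer_hi: "b - profile p u \<le> b - profile p (w * (1 - w))"
    using profile_mono[of p "w * (1 - w)" u] u wlo w p by simp
  have denom: "0 < u + s * b" using u0 s0 b0 by (intro add_pos_pos) auto
  \<comment> \<open>the lever arm can only decrease s', and by a factor of at least 1 / (1 + w ^ 3)\<close>
  have s'_lo: "slope p (w * (1 - w)) \<le> s'"
  proof -
    have "u + s * b \<le> u * (1 + w ^ 3)" using sb by (simp add: algebra_simps)
    also have "\<dots> \<le> w * (1 + w) * (1 + w ^ 3)" using u w by (intro mult_right_mono) auto
    finally have "slope p (w * (1 - w)) * (u + s * b) \<le> slope p (w * (1 - w)) * (w * (1 + w) * (1 + w ^ 3))"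
      using slope_nonneg p by (intro mult_left_mono) auto
    also have "\<dots> \<le> b - profile p u" using lower numer_lo by (simp add: mult_ac)
    finally show ?thesis using denom by (simp add: s' field_simps)
  qed
  have s'0: "0 < s'" using s'_lo slope_pos[of p "w * (1 - w)"] wlo w p by linarith
  have numer_pos: "0 < b - profile p u"
    using s'0 denom unfolding s' zero_less_divide_iff by linarith
  have s'_hi: "s' \<le> slope p (w * (c * (1 + w * c)))"
  proof -
    have "s' \<le> (b - profile p u) / u"
      unfolding s' using numer_pos u0 s0 b0 denom by (intro divide_left_mono) auto
    also have "\<dots> \<le> (b - profile p (w * (1 - w))) / (w * (1 - w))"
      using numer_pos numer_hi u u0 w half by (intro frac_le) auto
    also have "\<dots> \<le> slope p (w * (c * (1 + w * c)))"
    proof -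
      have "0 < w * (1 - w)" using w half by simp
      then show ?thesis using upper by (subst pos_divide_le_eq) (auto simp: c_def mult_ac)
    qed
    finally show ?thesis .
  qed
  have s'2: "s' \<le> slope p (2 * w)"
  proof -
    have "c * (1 + w * c) \<le> 1 * (1 + 1 * 1)" using c w half by (intro mult_mono add_mono) auto
    then have "w * (c * (1 + w * c)) \<le> 2 * w" using w by simp
    then have "slope p (w * (c * (1 + w * c))) \<le> slope p (2 * w)"
      using c w p by (intro slope_mono) auto
    then show ?thesis using s'_hi by simp
  qed
  have ss: "s * s' + s'\<^sup>2 \<le> w ^ 3"
  proof -
    have "s * s' \<le> slope p (2 * w) ^ 2" "s'\<^sup>2 \<le> slope p (2 * w) ^ 2"
      unfolding power2_eq_square using s2 s'2 s0 s'0 by (intro mult_mono; simp)+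
    then show ?thesis using drift by simp
  qed
  have sq: "0 < 1 + s'\<^sup>2" by (simp add: add_pos_nonneg)
  have "b' \<le> b"
  proof -
    have "0 \<le> s * s'" using s0 s'0 by simp
    then have "1 - s * s' \<le> 1 + s'\<^sup>2" using zero_le_power2[of s'] by linarith
    then have "b * (1 - s * s') \<le> b * (1 + s'\<^sup>2)" using b0 by simp
    then show ?thesis unfolding b' using sq by (subst pos_divide_le_eq)
  qed
  have "c * b \<le> b'"
  proof -
    have "c * (1 + s'\<^sup>2) \<le> 1 - s * s'"
    proof -
      have "c * s'\<^sup>2 \<le> 1 * s'\<^sup>2" using c by (intro mult_right_mono) auto
      then show ?thesis using ss by (simp add: c_def algebra_simps)
    qed
    then have "c * (1 + s'\<^sup>2) * b \<le> (1 - s * s') * b" using b0 by simp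
    then show ?thesis unfolding b' using sq by (subst pos_le_divide_eq) (simp_all add: mult_ac)
  qed
  then have "level p (w * c) \<le> b'"
    using level_shrink[of p w c] b c w p by simp
  moreover have "b' \<le> level p w" using \<open>b' \<le> b\<close> b by simp
  moreover have "continuous_on {w * c..w} (level p)"
    using c w by (intro continuous_on_subset[OF continuous_on_level]) (use p in auto)
  ultimately obtain w' where w': "w * c \<le> w'" "w' \<le> w" "level p w' = b'"
    using IVT'[of "level p" "w * c" b' w] c w by auto
  have w'0: "0 < w'" using mult_pos_pos[of w c] w'(1) c w by linarith
  \<comment> \<open>\<open>w * (1 - w)\<close> is increasing up to \<open>1 / 2\<close>\<close>
  have "w' * (1 - w') \<le> w * (1 - w)"
  proof -
    have "0 \<le> (w - w') * (1 - (w + w'))" using w' half by (intro mult_nonneg_nonneg) auto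
    then show ?thesis by (simp add: algebra_simps)
  qed
  then have "slope p (w' * (1 - w')) \<le> s'"
    using s'_lo slope_mono[of p "w' * (1 - w')" "w * (1 - w)"] w'0 w' half p by simp
  moreover have "s' \<le> slope p (w' * (1 + w'))"
  proof -
    have "w * c * (1 + w * c) \<le> w' * (1 + w')" using w' w'0 c w by (intro mult_mono) auto
    then show ?thesis using s'_hi slope_mono[of p "w * c * (1 + w * c)" "w' * (1 + w')"] c w p
      by (simp add: mult_ac)
  qed
  ultimately show ?thesis using w' w'0 by (auto simp: trapped_def)
qed

section \<open>The rate of decrease in the trap\<close>

lemma cesaro_of_increments:
  fixes z :: "nat \<Rightarrow> real"
  assumes "(\<lambda>t. z (Suc t) - z t) \<longlonglongrightarrow> D"
  shows "(\<lambda>t. z t / real t) \<longlonglongrightarrow> D"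
proof (rule LIMSEQ_I)
  fix e :: real assume e: "0 < e"
  obtain N where N: "\<And>t. t \<ge> N \<Longrightarrow> \<bar>z (Suc t) - z t - D\<bar> \<le> e / 2"
    using LIMSEQ_D[OF assms, of "e / 2"] e by (force intro: less_imp_le)
  have step: "\<bar>z (N + k) - z N - D * real k\<bar> \<le> e / 2 * real k" for k
  proof (induction k)
    case (Suc k)
    have "e / 2 * real (Suc k) = e / 2 * real k + e / 2" "D * real (Suc k) = D * real k + D"
      by (simp_all add: algebra_simps)
    then show ?case using N[of "N + k"] Suc unfolding add_Suc_right by linarith
  qed simp
  define M where "M = \<bar>z N\<bar> + \<bar>D\<bar> * real N"
  obtain n0 :: nat where n0: "2 * M / e < real n0" using reals_Archimedean2 by blast
  show "\<exists>no. \<forall>n\<ge>no. norm (z n / real n - D) < e"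
  proof (intro exI allI impI)
    fix n assume n: "n \<ge> max (Suc N) n0"
    have "2 * M / e < real n" using n n0 by linarith
    then have n1: "0 < real n" "M < e / 2 * real n"
      using n e by (auto simp: field_simps)
    have "\<bar>z n - D * real n\<bar> = \<bar>(z (N + (n - N)) - z N - D * real (n - N)) + z N - D * real N\<bar>"
      using n by (simp add: of_nat_diff algebra_simps)
    also have "\<dots> \<le> e / 2 * real (n - N) + M"
      using step[of "n - N"] abs_mult[of D "real N"] unfolding M_def abs_of_nat by linarith
    also have "\<dots> \<le> e / 2 * real n + M"
      using e by (intro add_right_mono mult_left_mono) auto
    also have "\<dots> < e * real n" using n1 by simp
    finally show "norm (z n / real n - D) < e"
      using n1 by (simp add: field_simps abs_less_iff)
  qed
qed

text \<open>
  The heights decrease to some limit \<open>L\<close>.  If \<open>L\<close> were positive, the slopes would be bounded below,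
  and each step would shrink the height by a fixed factor.
\<close>
lemma trapped_widths_tendsto_0:
  assumes p: "p \<ge> 3" and range: "trap_range p w0"
    and w: "\<And>t. 0 < w t" "\<And>t. w t \<le> w0"
    and trapped: "\<And>t. trapped p (w t) (s t) (b t)"
    and rec: "\<And>t. b (Suc t) = b t * (1 - s t * s (Suc t)) / (1 + (s (Suc t))\<^sup>2)"
  shows "filterlim w (at_right 0) sequentially"
proof -
  have half: "w t \<le> 1 / 2" for t using range w[of t] by (simp add: trap_range_def trap_conditions_def)
  have b: "b t = level p (w t)" for t using trapped by (simp add: trapped_def)
  have b0: "0 < b t" for t using b level_pos w p by simp
  have s_lo: "slope p (w t / 2) \<le> s t" for t
  proof -
    have "slope p (w t / 2) \<le> slope p (w t * (1 - w t))"
      using half[of t] w(1)[of t] p by (intro slope_mono) (auto simp: field_simps)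
    then show ?thesis using trapped[of t] by (simp add: trapped_def)
  qed
  have s0: "0 < s t" for t
    using s_lo[of t] slope_pos[of p "w t / 2"] w(1)[of t] p by simp
  have sq: "0 < 1 + (s t)\<^sup>2" for t by (simp add: add_pos_nonneg)
  have contract: "b (Suc t) * (1 + (s (Suc t))\<^sup>2) \<le> b t" for t
  proof -
    have "b (Suc t) * (1 + (s (Suc t))\<^sup>2) = b t * (1 - s t * s (Suc t))"
      using sq[of "Suc t"] rec[of t] by simp
    also have "\<dots> \<le> b t * 1"
      using b0[of t] s0[of t] s0[of "Suc t"] by (intro mult_left_mono) auto
    finally show ?thesis by simp
  qed
  have dec: "b (Suc t) \<le> b t" for t
  proof -
    have "b (Suc t) * 1 \<le> b (Suc t) * (1 + (s (Suc t))\<^sup>2)"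
      using b0[of "Suc t"] by (intro mult_left_mono) auto
    then show ?thesis using contract[of t] by simp
  qed
  then have "decseq b" by (rule decseq_SucI)
  moreover have "\<forall>t. 0 \<le> b t" using b0 by (simp add: less_imp_le)
  ultimately obtain L where L: "b \<longlonglongrightarrow> L" "\<forall>t. L \<le> b t"
    by (rule decseq_convergent)
  have "L = 0"
  proof (rule ccontr)
    assume "L \<noteq> 0"
    moreover have "0 \<le> L" using b0 by (intro LIMSEQ_le_const[OF L(1)]) (auto simp: less_imp_le)
    ultimately have L0: "0 < L" by simp
    define m where "m = L / level p 1"
    have l1: "0 < level p 1" using p by (intro level_pos) auto
    have m: "0 < m" using L0 l1 by (simp add: m_def)
    have "m \<le> w t" for t
    proof -
      have "level p (1 * w t) \<le> w t * level p 1"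
        using p w(1)[of t] half[of t] by (intro level_shrink) auto
      then show ?thesis using L(2)[rule_format, of t] b[of t] l1 by (simp add: m_def pos_divide_le_eq)
    qed
    then have "slope p (m / 2) \<le> s t" for t
      using s_lo[of t] slope_mono[of p "m / 2" "w t / 2"] m p by (simp add: order_trans)
    moreover define \<sigma> where "\<sigma> = slope p (m / 2)"
    ultimately have \<sigma>: "0 < \<sigma>" "\<And>t. \<sigma> \<le> s t" using slope_pos[of p "m / 2"] m p by auto
    have "b (Suc t) * (1 + \<sigma>\<^sup>2) \<le> b t" for t
    proof -
      have "b (Suc t) * (1 + \<sigma>\<^sup>2) \<le> b (Suc t) * (1 + (s (Suc t))\<^sup>2)"
        using b0[of "Suc t"] \<sigma> by (intro mult_left_mono add_left_mono power_mono) auto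
      then show ?thesis using contract[of t] by simp
    qed
    moreover have "(\<lambda>t. b (Suc t) * (1 + \<sigma>\<^sup>2)) \<longlonglongrightarrow> L * (1 + \<sigma>\<^sup>2)"
      by (rule tendsto_mult[OF LIMSEQ_Suc[OF L(1)] tendsto_const])
    ultimately have "L * (1 + \<sigma>\<^sup>2) \<le> L" using L(1) by (intro LIMSEQ_le) auto
    moreover have "0 < L * \<sigma>\<^sup>2" using L0 \<sigma> by simp
    ultimately show False by (simp add: algebra_simps)
  qed
  then have b_lim: "b \<longlonglongrightarrow> 0" using L by simp
  have "w \<longlonglongrightarrow> 0"
  proof (rule tendsto_sandwich[of "\<lambda>_. 0" _ _ "\<lambda>t. b t powr (1 / p)"])
    show "\<forall>\<^sub>F t in sequentially. w t \<le> b t powr (1 / p)"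
    proof (intro always_eventually allI)
      fix t
      have "w t powr p * 1 \<le> w t powr p * ((p + 1) / p + (p + 2) * w t)"
        using p w(1)[of t] by (intro mult_left_mono) (auto simp: field_simps)
      then have "w t powr p \<le> b t" using b[of t] level_eq[of p "w t"] w(1)[of t] p by simp
      then have "(w t powr p) powr (1 / p) \<le> b t powr (1 / p)"
        using p by (intro powr_mono2) auto
      then show "w t \<le> b t powr (1 / p)" using p w(1)[of t] by (simp add: powr_powr)
    qed
    have "(\<lambda>t. b t powr (1 / p)) \<longlonglongrightarrow> 0 powr (1 / p)"
      using p b0 by (intro tendsto_powr' b_lim tendsto_const) (auto simp: less_imp_le)
    then show "(\<lambda>t. b t powr (1 / p)) \<longlonglongrightarrow> 0" by simp
    show "\<forall>\<^sub>F t in sequentially. 0 \<le> w t"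
      using w(1) by (simp add: less_imp_le)
  qed auto
  then show "filterlim w (at_right 0) sequentially"
    using w(1) by (intro tendsto_imp_filterlim_at_right) auto
qed

text \<open>
  In the window \<open>s\<close> is asymptotic to \<open>w powr (p - 1)\<close> and \<open>b\<close> to \<open>(p + 1) / p * w powr p\<close>, so the
  relative decrease of \<open>b\<close>, about \<open>2 * s\<^sup>2\<close>, is asymptotic to a multiple of \<open>b powr \<beta>\<close> with
  \<open>\<beta> = 2 * (p - 1) / p\<close>.  Therefore the increments of \<open>b powr (- \<beta>)\<close> converge, and
  \<open>b powr (- \<beta>)\<close> grows linearly.
\<close>
lemma trapped_rate:
  assumes p: "p \<ge> 3" and range: "trap_range p w0"
    and w: "\<And>t. 0 < w t" "\<And>t. w t \<le> w0"
    and trapped: "\<And>t. trapped p (w t) (s t) (b t)"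
    and rec: "\<And>t. b (Suc t) = b t * (1 - s t * s (Suc t)) / (1 + (s (Suc t))\<^sup>2)"
  shows "s \<longlonglongrightarrow> 0"
    and "(\<lambda>t. b t * real t powr (p / (2 * (p - 1))))
      \<longlonglongrightarrow> (p + 1) / p * (p / (4 * (p - 1))) powr (p / (2 * (p - 1)))"
proof -
  have w_lim: "filterlim w (at_right 0) sequentially"
    by (rule trapped_widths_tendsto_0[where w = w and s = s and b = b, OF p range w trapped rec])
  have half: "w t \<le> 1 / 2" for t using range w[of t] by (simp add: trap_range_def trap_conditions_def)
  have b: "b t = level p (w t)" for t using trapped by (simp add: trapped_def)
  have b0: "0 < b t" for t using b level_pos w p by simp
  have s_bounds: "slope p (w t * (1 - w t)) \<le> s t" "s t \<le> slope p (w t * (1 + w t))" for t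
    using trapped by (auto simp: trapped_def)
  have s0: "0 < s t" for t
  proof -
    have "0 < w t * (1 - w t)" using half[of t] w(1)[of t] by simp
    then show ?thesis using s_bounds(1)[of t] slope_pos[of p "w t * (1 - w t)"] p by linarith
  qed
  have s_w: "(\<lambda>t. s t / w t powr (p - 1)) \<longlonglongrightarrow> 1"
  proof (rule tendsto_sandwich)
    show "\<forall>\<^sub>F t in sequentially. slope p (w t * (1 - w t)) / w t powr (p - 1) \<le> s t / w t powr (p - 1)"
      "\<forall>\<^sub>F t in sequentially. s t / w t powr (p - 1) \<le> slope p (w t * (1 + w t)) / w t powr (p - 1)"
      using s_bounds by (auto intro!: always_eventually divide_right_mono)
    have "((\<lambda>w. slope p (w * (1 - w)) / w powr (p - 1)) \<longlongrightarrow> 1) (at_right 0)"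
      using p unfolding slope_def by real_asymp
    then show "(\<lambda>t. slope p (w t * (1 - w t)) / w t powr (p - 1)) \<longlonglongrightarrow> 1"
      by (rule filterlim_compose[OF _ w_lim])
    have "((\<lambda>w. slope p (w * (1 + w)) / w powr (p - 1)) \<longlongrightarrow> 1) (at_right 0)"
      using p unfolding slope_def by real_asymp
    then show "(\<lambda>t. slope p (w t * (1 + w t)) / w t powr (p - 1)) \<longlonglongrightarrow> 1"
      by (rule filterlim_compose[OF _ w_lim])
  qed
  have w0_lim: "w \<longlonglongrightarrow> 0" using w_lim by (simp add: filterlim_at)
  have "(\<lambda>t. w t powr (p - 1)) \<longlonglongrightarrow> 0 powr (p - 1)"
    using p w(1) by (intro tendsto_powr' w0_lim tendsto_const) (auto simp: less_imp_le)
  then have "(\<lambda>t. s t / w t powr (p - 1) * w t powr (p - 1)) \<longlonglongrightarrow> 1 * 0"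
    using p by (intro tendsto_mult s_w) simp
  moreover have "s t / w t powr (p - 1) * w t powr (p - 1) = s t" for t
    using w(1)[of t] by simp
  ultimately show s_lim: "s \<longlonglongrightarrow> 0" by simp

  define \<beta> where "\<beta> = 2 * (p - 1) / p"
  define \<kappa> where "\<kappa> = ((p + 1) / p) powr (- (\<beta> / 2))"
  have \<beta>: "0 < \<beta>" using p by (simp add: \<beta>_def)
  have b_w: "(\<lambda>t. b t / w t powr p) \<longlonglongrightarrow> (p + 1) / p"
  proof -
    have "(\<lambda>t. (p + 1) / p + (p + 2) * w t) \<longlonglongrightarrow> (p + 1) / p + (p + 2) * 0"
      by (intro tendsto_intros w0_lim)
    moreover have "b t / w t powr p = (p + 1) / p + (p + 2) * w t" for t
      using b[of t] level_eq[of p "w t"] w(1)[of t] p by simp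
    ultimately show ?thesis by simp
  qed
  \<comment> \<open>the limit of \<open>r\<close> expresses the slope through the height\<close>
  define r where "r = (\<lambda>t. s t / b t powr (\<beta> / 2))"
  have r_lim: "r \<longlonglongrightarrow> \<kappa>"
  proof -
    have "(\<lambda>t. s t / w t powr (p - 1) * (b t / w t powr p) powr (- (\<beta> / 2))) \<longlonglongrightarrow> 1 * \<kappa>"
      unfolding \<kappa>_def using p by (intro tendsto_mult s_w tendsto_powr b_w tendsto_const) auto
    moreover have "s t / w t powr (p - 1) * (b t / w t powr p) powr (- (\<beta> / 2)) = r t" for t
    proof -
      have "p * (\<beta> / 2) = p - 1" using p by (simp add: \<beta>_def)
      then have "(w t powr p) powr (\<beta> / 2) = w t powr (p - 1)" by (simp only: powr_powr)
      then have e: "(b t / w t powr p) powr (\<beta> / 2) = b t powr (\<beta> / 2) / w t powr (p - 1)"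
        using b0[of t] by (simp add: powr_divide)
      show ?thesis
        unfolding r_def powr_minus e using w(1)[of t] by (simp add: field_simps)
    qed
    ultimately show ?thesis by simp
  qed
  \<comment> \<open>\<open>q\<close> is the contraction ratio of the height and \<open>y = 1 - q\<close> its relative decrease\<close>
  define q where "q = (\<lambda>t. b (Suc t) / b t)"
  have q: "q t = (1 - s t * s (Suc t)) / (1 + (s (Suc t))\<^sup>2)" for t
    using rec[of t] b0[of t] by (simp add: q_def)
  have s_Suc: "(\<lambda>t. s (Suc t)) \<longlonglongrightarrow> 0" using s_lim by (rule LIMSEQ_Suc)
  have den_lim: "(\<lambda>t. 1 + (s (Suc t))\<^sup>2) \<longlonglongrightarrow> 1 + 0\<^sup>2"
    by (intro tendsto_intros s_Suc)
  have q_lim: "q \<longlonglongrightarrow> 1"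
  proof -
    have "(\<lambda>t. (1 - s t * s (Suc t)) / (1 + (s (Suc t))\<^sup>2)) \<longlonglongrightarrow> (1 - 0 * 0) / (1 + 0\<^sup>2)"
      by (intro tendsto_intros s_lim s_Suc) auto
    then show ?thesis by (simp add: q[abs_def])
  qed
  define y where "y = (\<lambda>t. 1 - q t)"
  have sq: "0 < 1 + (s t)\<^sup>2" for t by (simp add: add_pos_nonneg)
  have y: "y t = (s t * s (Suc t) + (s (Suc t))\<^sup>2) / (1 + (s (Suc t))\<^sup>2)" for t
    using sq[of "Suc t"] by (simp add: y_def q field_simps)
  have y_pos: "0 < y t" for t
    unfolding y using s0[of t] s0[of "Suc t"] sq[of "Suc t"] by (intro divide_pos_pos add_pos_pos) auto
  have y_lim: "filterlim y (at_right 0) sequentially"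
  proof -
    have "y \<longlonglongrightarrow> 1 - 1" unfolding y_def by (intro tendsto_intros q_lim)
    then show ?thesis using y_pos by (intro tendsto_imp_filterlim_at_right) auto
  qed
  have y_b: "(\<lambda>t. y t / b t powr \<beta>) \<longlonglongrightarrow> 2 * \<kappa>\<^sup>2"
  proof -
    have r': "(\<lambda>t. r (Suc t) * q t powr (\<beta> / 2)) \<longlonglongrightarrow> \<kappa> * 1 powr (\<beta> / 2)"
      by (intro tendsto_mult LIMSEQ_Suc[OF r_lim] tendsto_powr q_lim tendsto_const) auto
    have "(\<lambda>t. (r t * (r (Suc t) * q t powr (\<beta> / 2)) + (r (Suc t) * q t powr (\<beta> / 2))\<^sup>2) / (1 + (s (Suc t))\<^sup>2))
        \<longlonglongrightarrow> (\<kappa> * (\<kappa> * 1 powr (\<beta> / 2)) + (\<kappa> * 1 powr (\<beta> / 2))\<^sup>2) / (1 + 0\<^sup>2)"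
      by (intro tendsto_divide tendsto_add tendsto_mult tendsto_power r' r_lim den_lim) auto
    moreover have "(r t * (r (Suc t) * q t powr (\<beta> / 2)) + (r (Suc t) * q t powr (\<beta> / 2))\<^sup>2) / (1 + (s (Suc t))\<^sup>2)
        = y t / b t powr \<beta>" for t
    proof -
      have "q t powr (\<beta> / 2) = b (Suc t) powr (\<beta> / 2) / b t powr (\<beta> / 2)"
        using b0[of t] b0[of "Suc t"] by (simp add: q_def powr_divide)
      then have e: "r (Suc t) * q t powr (\<beta> / 2) = s (Suc t) / b t powr (\<beta> / 2)"
        using b0[of "Suc t"] by (simp add: r_def)
      have bb: "b t powr \<beta> = b t powr (\<beta> / 2) * b t powr (\<beta> / 2)"
        by (simp flip: powr_add)
      show ?thesis unfolding e unfolding y bb r_def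
        by (simp add: power2_eq_square add_divide_distrib mult_ac)
    qed
    ultimately show ?thesis by (simp add: power2_eq_square)
  qed
  define z where "z = (\<lambda>t. b t powr (- \<beta>))"
  have z_inc: "(\<lambda>t. z (Suc t) - z t) \<longlonglongrightarrow> 2 * \<kappa>\<^sup>2 * \<beta>"
  proof -
    \<comment> \<open>\<open>z (Suc t) - z t = z t * ((1 - y t) powr (- \<beta>) - 1)\<close>, and \<open>(1 - y) powr (- \<beta>) - 1\<close> is about \<open>\<beta> * y\<close>\<close>
    have "((\<lambda>y. ((1 - y) powr (- \<beta>) - 1) / y) \<longlongrightarrow> \<beta>) (at_right 0)"
      using \<beta> by real_asymp
    then have "(\<lambda>t. ((1 - y t) powr (- \<beta>) - 1) / y t) \<longlonglongrightarrow> \<beta>"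
      by (rule filterlim_compose[OF _ y_lim])
    then have "(\<lambda>t. y t / b t powr \<beta> * (((1 - y t) powr (- \<beta>) - 1) / y t)) \<longlonglongrightarrow> 2 * \<kappa>\<^sup>2 * \<beta>"
      by (intro tendsto_mult y_b)
    moreover have "y t / b t powr \<beta> * (((1 - y t) powr (- \<beta>) - 1) / y t) = z (Suc t) - z t" for t
    proof -
      have "b (Suc t) = b t * (1 - y t)" using b0[of t] by (simp add: y_def q_def)
      moreover have "0 < 1 - y t" using b0[of t] b0[of "Suc t"] by (simp add: y_def q_def)
      ultimately have "z (Suc t) = z t * (1 - y t) powr (- \<beta>)"
        using b0[of t] by (simp add: z_def powr_mult)
      moreover have "z t = 1 / b t powr \<beta>" by (simp add: z_def powr_minus divide_simps)
      moreover have "0 < b t powr \<beta>" using b0[of t] by simp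
      ultimately show ?thesis using y_pos[of t] by (simp add: field_simps)
    qed
    ultimately show ?thesis by simp
  qed
  define D where "D = 2 * \<kappa>\<^sup>2 * \<beta>"
  have \<kappa>0: "0 < \<kappa>" using p by (simp add: \<kappa>_def)
  have D0: "0 < D" using \<beta> \<kappa>0 by (simp add: D_def)
  have "(\<lambda>t. z t / real t) \<longlonglongrightarrow> D"
    using cesaro_of_increments[OF z_inc] by (simp add: D_def)
  then have lim: "(\<lambda>t. (z t / real t) powr (- (1 / \<beta>))) \<longlonglongrightarrow> D powr (- (1 / \<beta>))"
    using D0 by (intro tendsto_powr tendsto_const) auto
  have \<beta>': "1 / \<beta> = p / (2 * (p - 1))" using p by (simp add: \<beta>_def)
  have "\<forall>\<^sub>F t in sequentially. (z t / real t) powr (- (1 / \<beta>)) = b t * real t powr (p / (2 * (p - 1)))"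
    using eventually_gt_at_top[of 0]
  proof eventually_elim
    case (elim t)
    have "(z t / real t) powr (- (1 / \<beta>)) = z t powr (- (1 / \<beta>)) / real t powr (- (1 / \<beta>))"
      using elim by (simp add: powr_divide z_def)
    also have "z t powr (- (1 / \<beta>)) = b t" using \<beta> b0[of t] by (simp add: z_def powr_powr)
    finally have "(z t / real t) powr (- (1 / \<beta>)) = b t * real t powr (1 / \<beta>)"
      unfolding powr_minus[of "real t"] using elim by (simp add: field_simps)
    then show ?case by (simp only: \<beta>')
  qed
  then have "(\<lambda>t. b t * real t powr (p / (2 * (p - 1)))) \<longlonglongrightarrow> D powr (- (1 / \<beta>))"
    using lim by (rule Lim_transform_eventually[rotated])
  also have "D powr (- (1 / \<beta>)) = (p + 1) / p * (p / (4 * (p - 1))) powr (p / (2 * (p - 1)))"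
  proof -
    have k2: "\<kappa>\<^sup>2 = ((p + 1) / p) powr (- \<beta>)"
      by (simp add: \<kappa>_def power2_eq_square flip: powr_add)
    have "D = (4 * (p - 1) / p) * ((p + 1) / p) powr (- \<beta>)"
      unfolding D_def k2 by (simp add: \<beta>_def)
    then have "D powr (- (1 / \<beta>)) = (4 * (p - 1) / p) powr (- (1 / \<beta>)) * (((p + 1) / p) powr (- \<beta>)) powr (- (1 / \<beta>))"
      using p by (simp only: powr_mult)
    also have "(((p + 1) / p) powr (- \<beta>)) powr (- (1 / \<beta>)) = (p + 1) / p"
      using \<beta> p by (simp add: powr_powr)
    also have "(4 * (p - 1) / p) powr (- (1 / \<beta>)) = (p / (4 * (p - 1))) powr (1 / \<beta>)"
      using p by (simp add: powr_minus powr_divide divide_simps)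
    finally show ?thesis using \<beta>' by (simp add: mult.commute)
  qed
  finally show "(\<lambda>t. b t * real t powr (p / (2 * (p - 1))))
      \<longlonglongrightarrow> (p + 1) / p * (p / (4 * (p - 1))) powr (p / (2 * (p - 1)))" .
qed

section \<open>Uniform convexity of powers of the norm\<close>

lemma convex_on_powr:
  fixes r :: real
  assumes "1 \<le> r"
  shows "convex_on {0..} (\<lambda>x::real. x powr r)"
proof (rule convex_onI)
  fix t x y :: real
  assume t: "0 < t" "t < 1" and xy: "x \<in> {0..}" "y \<in> {0..}"
  have shrink: "c powr r \<le> c" if "0 < c" "c < 1" for c :: real
    using powr_mono'[of 1 r c] that assms by simp
  show "((1 - t) *\<^sub>R x + t *\<^sub>R y) powr r \<le> (1 - t) * x powr r + t * y powr r"
  proof (cases "x = 0 \<or> y = 0")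
    case True
    then show ?thesis
      using t xy shrink[of t] shrink[of "1 - t"]
      by (auto simp: powr_mult intro!: mult_right_mono)
  next
    case False
    then show ?thesis
      using convex_onD[OF powr_convex[OF assms], of t x y] t xy by auto
  qed
qed auto

lemma powr_superadditive:
  fixes a b r :: real
  assumes "0 \<le> a" "0 \<le> b" "1 \<le> r"
  shows "a powr r + b powr r \<le> (a + b) powr r"
proof -
  have split: "c powr r = c * c powr (r - 1)" if "0 \<le> c" for c :: real
    using that by (cases "c = 0") (auto simp: powr_diff)
  have "a powr r + b powr r \<le> a * (a + b) powr (r - 1) + b * (a + b) powr (r - 1)"
    unfolding split[OF assms(1)] split[OF assms(2)]
    using assms by (intro add_mono mult_left_mono powr_mono2) auto
  also have "\<dots> = (a + b) powr r"
    using assms by (simp add: split[of "a + b"] distrib_right)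
  finally show ?thesis .
qed

lemma norm_powr_eq: "norm x powr p = ((norm x)\<^sup>2) powr (p / 2)"
  for x :: "'a::real_normed_vector"
  by (cases "x = 0") (simp_all add: powr_powr flip: powr_numeral)

text \<open>
  The parallelogram identity, raised to the power \<open>p / 2 \<ge> 1\<close>: superadditivity of that power keeps
  the defect, and its convexity splits the average of the squared norms.
\<close>
lemma norm_powr_midpoint:
  fixes x y :: "'a::real_inner"
  assumes "2 \<le> p"
  shows "norm ((1/2) *\<^sub>R (x + y)) powr p
    \<le> (norm x powr p + norm y powr p) / 2 - (norm (x - y) / 2) powr p"
proof -
  define A where "A = (norm ((1/2) *\<^sub>R (x + y)))\<^sup>2"
  define Q where "Q = (norm ((1/2) *\<^sub>R (x - y)))\<^sup>2"
  have sum: "A + Q = ((norm x)\<^sup>2 + (norm y)\<^sup>2) / 2"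
    unfolding A_def Q_def power2_norm_eq_inner
    by (simp add: inner_simps inner_commute field_simps)
  have "A powr (p / 2) + Q powr (p / 2) \<le> (A + Q) powr (p / 2)"
    using assms by (intro powr_superadditive) (auto simp: A_def Q_def)
  also have "\<dots> \<le> (((norm x)\<^sup>2) powr (p / 2) + ((norm y)\<^sup>2) powr (p / 2)) / 2"
    unfolding sum using convex_onD[OF convex_on_powr[of "p / 2"], of "1/2" "(norm x)\<^sup>2" "(norm y)\<^sup>2"] assms
    by (simp add: add_divide_distrib)
  finally have "norm ((1/2) *\<^sub>R (x + y)) powr p + norm ((1/2) *\<^sub>R (x - y)) powr p
      \<le> (norm x powr p + norm y powr p) / 2"
    unfolding A_def Q_def norm_powr_eq[symmetric] .
  moreover have half: "norm ((1/2) *\<^sub>R (x - y)) = norm (x - y) / 2" by simp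
  ultimately show ?thesis unfolding half by linarith
qed

lemma convex_on_norm_linear_powr:
  fixes f :: "'a::real_vector \<Rightarrow> 'b::real_normed_vector"
  assumes "linear f" "1 \<le> r"
  shows "convex_on UNIV (\<lambda>x. norm (f x) powr r)"
proof (rule convex_onI)
  fix t :: real and x y
  assume t: "0 < t" "t < 1"
  interpret linear f by fact
  have "norm (f ((1 - t) *\<^sub>R x + t *\<^sub>R y)) \<le> (1 - t) * norm (f x) + t * norm (f y)"
    using norm_triangle_ineq[of "(1 - t) *\<^sub>R f x" "t *\<^sub>R f y"] t by (simp add: add scaleR)
  then have "norm (f ((1 - t) *\<^sub>R x + t *\<^sub>R y)) powr r \<le> ((1 - t) * norm (f x) + t * norm (f y)) powr r"
    using assms by (intro powr_mono2) auto
  also have "\<dots> \<le> (1 - t) * norm (f x) powr r + t * norm (f y) powr r"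
    using convex_onD[OF convex_on_powr[OF assms(2)], of t "norm (f x)" "norm (f y)"] t by simp
  finally show "norm (f ((1 - t) *\<^sub>R x + t *\<^sub>R y)) powr r
      \<le> (1 - t) * norm (f x) powr r + t * norm (f y) powr r" .
qed auto

text \<open>
  For \<open>\<eta> \<le> 1 / 2\<close> the point \<open>\<eta> *\<^sub>R x + (1 - \<eta>) *\<^sub>R y\<close> is a convex combination of the midpoint, with
  weight \<open>2 * \<eta>\<close>, and \<open>y\<close>; the gap at the midpoint is inherited with that weight.
\<close>
lemma convex_gap_from_midpoint:
  fixes f :: "'a::real_vector \<Rightarrow> real"
  assumes conv: "convex_on UNIV f" and \<eta>: "\<eta> \<in> {0..1}" and \<omega>: "0 \<le> \<omega>"
    and mid: "f ((1/2) *\<^sub>R (x + y)) \<le> (f x + f y) / 2 - \<omega>"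
  shows "f (\<eta> *\<^sub>R x + (1 - \<eta>) *\<^sub>R y) \<le> \<eta> * f x + (1 - \<eta>) * f y - \<eta> * (1 - \<eta>) * (2 * \<omega>)"
proof -
  have half: "f (\<kappa> *\<^sub>R a + (1 - \<kappa>) *\<^sub>R c) \<le> \<kappa> * f a + (1 - \<kappa>) * f c - \<kappa> * (1 - \<kappa>) * (2 * \<omega>)"
    if \<kappa>: "0 \<le> \<kappa>" "\<kappa> \<le> 1/2" and m: "f ((1/2) *\<^sub>R (a + c)) \<le> (f a + f c) / 2 - \<omega>" for \<kappa> a c
  proof -
    have "\<kappa> *\<^sub>R a + (1 - \<kappa>) *\<^sub>R c = (1 - 2 * \<kappa>) *\<^sub>R c + (2 * \<kappa>) *\<^sub>R ((1/2) *\<^sub>R (a + c))"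
      by (simp add: algebra_simps flip: scaleR_add_left)
    then have "f (\<kappa> *\<^sub>R a + (1 - \<kappa>) *\<^sub>R c) \<le> (1 - 2 * \<kappa>) * f c + 2 * \<kappa> * f ((1/2) *\<^sub>R (a + c))"
      using convex_onD[OF conv, of "2 * \<kappa>" c "(1/2) *\<^sub>R (a + c)"] \<kappa> by simp
    also have "\<dots> \<le> (1 - 2 * \<kappa>) * f c + 2 * \<kappa> * ((f a + f c) / 2 - \<omega>)"
      using m \<kappa> by (intro add_left_mono mult_left_mono) auto
    also have "\<dots> = \<kappa> * f a + (1 - \<kappa>) * f c - 2 * \<kappa> * \<omega>" by (simp add: field_simps)
    also have "\<dots> \<le> \<kappa> * f a + (1 - \<kappa>) * f c - \<kappa> * (1 - \<kappa>) * (2 * \<omega>)"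
      using \<kappa> \<omega> by (simp add: algebra_simps)
    finally show ?thesis .
  qed
  show ?thesis
  proof (cases "\<eta> \<le> 1/2")
    case True
    then show ?thesis using half[of \<eta> x y] mid \<eta> by simp
  next
    case False
    then show ?thesis using half[of "1 - \<eta>" y x] mid \<eta> by (simp add: add.commute mult_ac)
  qed
qed

section \<open>The constraint set\<close>

definition horizontal :: "'a::real_inner \<Rightarrow> 'a \<Rightarrow> 'a" where
  "horizontal e x = x - (x \<bullet> e) *\<^sub>R e"

text \<open>
  Negative exactly in the interior of the rotationally symmetric epigraph of the profile with axis \<open>e\<close>.
\<close>
definition excess :: "real \<Rightarrow> 'a::real_inner \<Rightarrow> 'a \<Rightarrow> real" where
  "excess p e x = profile p (norm (horizontal e x)) - x \<bullet> e"

definition body :: "real \<Rightarrow> 'a::real_inner \<Rightarrow> 'a set" where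
  "body p e = {x. excess p e x \<le> 0 \<and> norm x \<le> 1}"

lemma linear_horizontal: "linear (horizontal e)"
  by (rule linearI) (simp_all add: horizontal_def inner_add_left algebra_simps)

lemma horizontal_add: "horizontal e (x + y) = horizontal e x + horizontal e y"
  by (rule linear_add[OF linear_horizontal])

lemma horizontal_diff: "horizontal e (x - y) = horizontal e x - horizontal e y"
  by (rule linear_diff[OF linear_horizontal])

lemma horizontal_scaleR: "horizontal e (c *\<^sub>R x) = c *\<^sub>R horizontal e x"
  by (rule linear_scale[OF linear_horizontal])

lemma norm_horizontal_le:
  assumes "norm e = 1"
  shows "norm (horizontal e x) \<le> norm x"
proof -
  have ee: "e \<bullet> e = 1" using assms by (simp add: norm_eq_1)
  have "(norm (horizontal e x))\<^sup>2 = (norm x)\<^sup>2 - (x \<bullet> e)\<^sup>2"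
    unfolding horizontal_def power2_norm_eq_inner using ee
    by (simp add: inner_simps inner_commute power2_eq_square)
  then have "(norm (horizontal e x))\<^sup>2 \<le> (norm x)\<^sup>2" by simp
  then show ?thesis by (simp add: power2_le_iff_abs_le)
qed

lemma convex_on_excess:
  assumes "1 \<le> p"
  shows "convex_on UNIV (excess p e)"
proof -
  have "convex_on UNIV (\<lambda>x. - (x \<bullet> e))"
    by (rule convex_onI) (simp_all add: inner_add_left)
  moreover have "convex_on UNIV (\<lambda>x. (1 / p) * norm (horizontal e x) powr p)"
    using assms by (intro convex_on_cmul convex_on_norm_linear_powr linear_horizontal) auto
  moreover have "convex_on UNIV (\<lambda>x. norm (horizontal e x) powr (p + 1))"
    using assms by (intro convex_on_norm_linear_powr linear_horizontal) auto
  ultimately have "convex_on UNIV (\<lambda>x. ((1 / p) * norm (horizontal e x) powr p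
      + norm (horizontal e x) powr (p + 1)) + - (x \<bullet> e))"
    by (intro convex_on_add)
  then show ?thesis by (simp add: excess_def[abs_def] profile_def)
qed

lemma excess_midpoint:
  assumes "2 \<le> p"
  shows "excess p e ((1/2) *\<^sub>R (x + y))
    \<le> (excess p e x + excess p e y) / 2 - (norm (horizontal e (x - y)) / 2) powr p / p"
proof -
  let ?X = "horizontal e x" and ?Y = "horizontal e y"
  have "norm ((1/2) *\<^sub>R (?X + ?Y)) powr p / p
      \<le> ((norm ?X powr p + norm ?Y powr p) / 2 - (norm (?X - ?Y) / 2) powr p) / p"
    using assms by (intro divide_right_mono norm_powr_midpoint) auto
  moreover have "norm ((1/2) *\<^sub>R (?X + ?Y)) powr (p + 1)
      \<le> (norm ?X powr (p + 1) + norm ?Y powr (p + 1)) / 2"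
    using norm_powr_midpoint[of "p + 1" ?X ?Y] assms powr_ge_zero[of "norm (?X - ?Y) / 2" "p + 1"]
    by linarith
  ultimately show ?thesis
    unfolding excess_def profile_def horizontal_scaleR horizontal_add horizontal_diff
    by (simp add: inner_add_left add_divide_distrib diff_divide_distrib)
qed


lemma continuous_on_excess:
  assumes "0 < p"
  shows "continuous_on UNIV (excess p e)"
proof -
  have "continuous_on UNIV (\<lambda>x. profile p (norm (horizontal e x)))"
    by (rule continuous_on_compose2[OF continuous_on_profile[OF assms]])
       (auto simp: horizontal_def intro!: continuous_intros)
  then show ?thesis
    unfolding excess_def by (intro continuous_intros)
qed

lemma body_eq: "body p e = {x. excess p e x \<le> 0} \<inter> cball 0 1"
  by (auto simp: body_def)

lemma closed_body: "0 < p \<Longrightarrow> closed (body p e)"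
  unfolding body_eq by (intro closed_Int closed_Collect_le continuous_on_excess continuous_intros) auto

lemma compact_body:
  fixes e :: "'a::euclidean_space"
  assumes "0 < p"
  shows "compact (body p e)"
  using closed_body[OF assms, of e] bounded_subset[OF bounded_cball, of "body p e" 0 1]
  by (auto simp: compact_eq_bounded_closed body_eq)

lemma convex_body:
  assumes "1 \<le> p"
  shows "convex (body p e)"
proof -
  have "convex {x. excess p e x \<le> 0}"
  proof (rule convexI, clarsimp)
    fix x y and u v :: real
    assume *: "excess p e x \<le> 0" "excess p e y \<le> 0" "0 \<le> u" "0 \<le> v" "u + v = 1"
    then have "excess p e (u *\<^sub>R x + v *\<^sub>R y) \<le> u * excess p e x + v * excess p e y"
      using convex_on_excess[OF assms, of e] unfolding convex_on_def by blast
    also have "\<dots> \<le> 0" using * by (intro add_nonpos_nonpos mult_nonneg_nonpos)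
    finally show "excess p e (u *\<^sub>R x + v *\<^sub>R y) \<le> 0" .
  qed
  then show ?thesis unfolding body_eq by (intro convex_Int) auto
qed

lemma excess_lipschitz:
  assumes p: "1 < p" and e: "norm e = 1" and xy: "norm x \<le> R" "norm y \<le> R"
  shows "\<bar>excess p e x - excess p e y\<bar> \<le> (slope p R + 1) * norm (x - y)"
proof -
  have "\<bar>norm (horizontal e x) - norm (horizontal e y)\<bar> \<le> norm (x - y)"
    using norm_triangle_ineq3[of "horizontal e x" "horizontal e y"]
      norm_horizontal_le[OF e, of "x - y"] by (simp add: horizontal_diff)
  then have "slope p R * \<bar>norm (horizontal e x) - norm (horizontal e y)\<bar> \<le> slope p R * norm (x - y)"
    using slope_nonneg[of p R] p by (intro mult_left_mono) auto
  moreover have "\<bar>profile p (norm (horizontal e x)) - profile p (norm (horizontal e y))\<bar>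
      \<le> slope p R * \<bar>norm (horizontal e x) - norm (horizontal e y)\<bar>"
    using norm_horizontal_le[OF e, of x] norm_horizontal_le[OF e, of y] xy p
    by (intro profile_lipschitz) auto
  moreover have "\<bar>x \<bullet> e - y \<bullet> e\<bar> \<le> norm (x - y)"
    using Cauchy_Schwarz_ineq2[of "x - y" e] e by (simp add: inner_diff_left)
  ultimately show ?thesis by (simp add: excess_def distrib_right)
qed

text \<open>
  If the horizontal parts of \<open>x\<close> and \<open>y\<close> differ by at least a fixed fraction of \<open>norm (x - y)\<close>, then
  the gap comes from the power \<open>p\<close> of the horizontal norm.  Otherwise \<open>x - y\<close> is nearly vertical, so
  \<open>excess\<close> differs at the two points by at least \<open>norm (x - y) / 2\<close>; one of them then lies well inside
  the epigraph, which is stronger because the body is bounded.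
\<close>
lemma excess_uniformly_convex:
  assumes p: "2 \<le> p" and e: "norm e = 1"
  obtains c where "0 < c" and
    "\<And>x y \<eta>. \<lbrakk>x \<in> body p e; y \<in> body p e; \<eta> \<in> {0..1}\<rbrakk> \<Longrightarrow>
      excess p e (\<eta> *\<^sub>R x + (1 - \<eta>) *\<^sub>R y) \<le> - (\<eta> * (1 - \<eta>) * (c * norm (x - y) powr p))"
proof -
  define L where "L = slope p 1 + 1"
  \<comment> \<open>small enough for the horizontal part to change the excess by at most a quarter of the distance\<close>
  define \<tau> where "\<tau> = 1 / (4 * L)"
  define c1 where "c1 = 2 * ((\<tau> / 2) powr p / p)"
  define c2 where "c2 = 2 powr (- p)"
  have L: "1 \<le> L" using slope_nonneg[of p 1] p by (simp add: L_def)
  then have \<tau>: "0 < \<tau>" "\<tau> \<le> 1 / 4" "L * \<tau> = 1 / 4" by (auto simp: \<tau>_def field_simps)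
  show ?thesis
  proof (rule that[of "min c1 c2"])
    show "0 < min c1 c2" using \<tau> p by (simp add: c1_def c2_def)
    fix x y \<eta>
    assume x: "x \<in> body p e" and y: "y \<in> body p e" and \<eta>: "\<eta> \<in> {0..1::real}"
    define D where "D = norm (x - y)"
    define d where "d = norm (horizontal e (x - y))"
    have D: "0 \<le> D" "D \<le> 2"
      using norm_triangle_ineq4[of x y] x y by (auto simp: D_def body_def)
    have ex: "excess p e x \<le> 0" "excess p e y \<le> 0" using x y by (auto simp: body_def)
    have w: "0 \<le> \<eta> * (1 - \<eta>)" using \<eta> by simp
    have gap: "excess p e (\<eta> *\<^sub>R x + (1 - \<eta>) *\<^sub>R y)
        \<le> \<eta> * excess p e x + (1 - \<eta>) * excess p e y - \<eta> * (1 - \<eta>) * (2 * ((d / 2) powr p / p))"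
      using convex_gap_from_midpoint[where f = "excess p e" and x = x and y = y
          and \<omega> = "(d / 2) powr p / p" and \<eta> = \<eta>]
        convex_on_excess[of p e] excess_midpoint[OF p, of e x y] \<eta> p
      by (simp add: d_def mult_ac)
    have weaken: "- (\<eta> * (1 - \<eta>) * (c * D powr p)) \<le> - (\<eta> * (1 - \<eta>) * (min c1 c2 * D powr p))"
      if "min c1 c2 \<le> c" for c
      using that w by (intro le_imp_neg_le mult_left_mono mult_right_mono) auto
    have "excess p e (\<eta> *\<^sub>R x + (1 - \<eta>) *\<^sub>R y) \<le> - (\<eta> * (1 - \<eta>) * (min c1 c2 * D powr p))"
    proof (cases "\<tau> * D \<le> d")
      case True
      have "\<eta> * excess p e x + (1 - \<eta>) * excess p e y \<le> 0"
        using ex \<eta> by (intro add_nonpos_nonpos mult_nonneg_nonpos) auto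
      moreover have "(\<tau> / 2) powr p * D powr p \<le> (d / 2) powr p"
      proof -
        have "(\<tau> / 2) powr p * D powr p = (\<tau> / 2 * D) powr p"
          using \<tau> D by (subst powr_mult) auto
        also have "\<dots> \<le> (d / 2) powr p" using True \<tau> D p by (intro powr_mono2) auto
        finally show ?thesis .
      qed
      then have "c1 * D powr p \<le> 2 * ((d / 2) powr p / p)"
        using p by (simp add: c1_def divide_right_mono)
      then have "\<eta> * (1 - \<eta>) * (c1 * D powr p) \<le> \<eta> * (1 - \<eta>) * (2 * ((d / 2) powr p / p))"
        using w by (rule mult_left_mono)
      ultimately have "excess p e (\<eta> *\<^sub>R x + (1 - \<eta>) *\<^sub>R y) \<le> - (\<eta> * (1 - \<eta>) * (c1 * D powr p))"
        using gap by linarith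
      then show ?thesis using weaken[of c1] by linarith
    next
      case False
      have "norm (x - y) \<le> d + \<bar>(x - y) \<bullet> e\<bar>"
        using norm_triangle_ineq[of "horizontal e (x - y)" "((x - y) \<bullet> e) *\<^sub>R e"] e
        by (simp add: d_def horizontal_def)
      moreover have "L * d \<le> D / 4"
        using mult_left_mono[of d "\<tau> * D" L] False L \<tau> by (simp flip: mult.assoc)
      moreover have "\<bar>profile p (norm (horizontal e x)) - profile p (norm (horizontal e y))\<bar> \<le> slope p 1 * d"
      proof -
        have "\<bar>profile p (norm (horizontal e x)) - profile p (norm (horizontal e y))\<bar>
            \<le> slope p 1 * \<bar>norm (horizontal e x) - norm (horizontal e y)\<bar>"
          using norm_horizontal_le[OF e, of x] norm_horizontal_le[OF e, of y] x y p
          by (intro profile_lipschitz) (auto simp: body_def)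
        also have "\<dots> \<le> slope p 1 * d"
          using norm_triangle_ineq3[of "horizontal e x" "horizontal e y"] slope_nonneg[of p 1] p
          by (intro mult_left_mono) (auto simp: d_def horizontal_diff)
        finally show ?thesis .
      qed
      moreover have "excess p e x - excess p e y = profile p (norm (horizontal e x))
          - profile p (norm (horizontal e y)) - (x - y) \<bullet> e"
        by (simp add: excess_def inner_diff_left)
      moreover have "L * d = slope p 1 * d + d" by (simp add: L_def algebra_simps)
      ultimately have "D / 2 \<le> \<bar>excess p e x - excess p e y\<bar>"
        using D unfolding D_def[symmetric] by linarith
      then consider "excess p e x \<le> - (D / 2)" | "excess p e y \<le> - (D / 2)"
        using ex by linarith
      then have "\<eta> * excess p e x + (1 - \<eta>) * excess p e y \<le> - (\<eta> * (1 - \<eta>) * (D / 2))"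
      proof cases
        case 1
        have "\<eta> * excess p e x \<le> \<eta> * - (D / 2)" using 1 \<eta> by (intro mult_left_mono) auto
        moreover have "(1 - \<eta>) * excess p e y \<le> 0" using ex \<eta> by (intro mult_nonneg_nonpos) auto
        moreover have "\<eta> * (1 - \<eta>) * (D / 2) \<le> \<eta> * 1 * (D / 2)"
          using \<eta> D by (intro mult_right_mono mult_left_mono) auto
        ultimately show ?thesis by simp
      next
        case 2
        have "(1 - \<eta>) * excess p e y \<le> (1 - \<eta>) * - (D / 2)" using 2 \<eta> by (intro mult_left_mono) auto
        moreover have "\<eta> * excess p e x \<le> 0" using ex \<eta> by (intro mult_nonneg_nonpos) auto
        moreover have "\<eta> * (1 - \<eta>) * (D / 2) \<le> 1 * (1 - \<eta>) * (D / 2)"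
          using \<eta> D by (intro mult_right_mono) auto
        ultimately show ?thesis by simp
      qed
      moreover have "c2 * D powr p \<le> D / 2"
      proof (cases "D = 0")
        case False
        then have "0 < D" using D by simp
        have "c2 * D powr p = (D / 2) powr p"
          using D by (simp add: c2_def powr_divide powr_minus field_simps)
        also have "\<dots> \<le> (D / 2) powr 1" using \<open>0 < D\<close> D p by (intro powr_mono') auto
        finally show ?thesis using \<open>0 < D\<close> by simp
      qed simp
      then have "\<eta> * (1 - \<eta>) * (c2 * D powr p) \<le> \<eta> * (1 - \<eta>) * (D / 2)"
        using w by (rule mult_left_mono)
      moreover have "0 \<le> \<eta> * (1 - \<eta>) * (2 * ((d / 2) powr p / p))" using w p by simp
      ultimately have "excess p e (\<eta> *\<^sub>R x + (1 - \<eta>) *\<^sub>R y) \<le> - (\<eta> * (1 - \<eta>) * (c2 * D powr p))"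
        using gap by linarith
      then show ?thesis using weaken[of c2] by linarith
    qed
    then show "excess p e (\<eta> *\<^sub>R x + (1 - \<eta>) *\<^sub>R y)
        \<le> - (\<eta> * (1 - \<eta>) * (min c1 c2 * norm (x - y) powr p))"
      by (simp add: D_def)
  qed
qed

lemma norm_convex_combination_le:
  fixes x y :: "'a::real_inner"
  assumes "norm x \<le> 1" "norm y \<le> 1" "\<eta> \<in> {0..1}"
  shows "norm (\<eta> *\<^sub>R x + (1 - \<eta>) *\<^sub>R y) \<le> 1 - \<eta> * (1 - \<eta>) * (norm (x - y))\<^sup>2 / 2"
proof -
  define a where "a = \<eta> * (1 - \<eta>) * (norm (x - y))\<^sup>2"
  have "(norm (\<eta> *\<^sub>R x + (1 - \<eta>) *\<^sub>R y))\<^sup>2 = \<eta> * (norm x)\<^sup>2 + (1 - \<eta>) * (norm y)\<^sup>2 - a"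
    unfolding a_def power2_norm_eq_inner by (simp add: inner_simps inner_commute algebra_simps)
  also have "\<dots> \<le> \<eta> * 1 + (1 - \<eta>) * 1 - a"
    using assms by (intro diff_right_mono add_mono mult_left_mono) (auto simp: power_le_one)
  also have "\<dots> \<le> (1 - a / 2)\<^sup>2" by (simp add: power2_eq_square algebra_simps)
  finally have sq: "(norm (\<eta> *\<^sub>R x + (1 - \<eta>) *\<^sub>R y))\<^sup>2 \<le> (1 - a / 2)\<^sup>2" .
  have "a \<le> 1 / 4 * 4"
    unfolding a_def
  proof (intro mult_mono)
    have "0 \<le> (\<eta> - 1 / 2)\<^sup>2" by simp
    then show "\<eta> * (1 - \<eta>) \<le> 1 / 4" by (simp add: power2_eq_square algebra_simps)
    have "norm (x - y) \<le> 2" using norm_triangle_ineq4[of x y] assms by simp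
    then have "(norm (x - y))\<^sup>2 \<le> 2\<^sup>2" by (intro power_mono) auto
    then show "(norm (x - y))\<^sup>2 \<le> 4" by simp
  qed auto
  then show ?thesis
    using power2_le_imp_le[OF sq] by (simp add: a_def)
qed

text \<open>
  The slack of the epigraph constraint at a convex combination, divided by its Lipschitz constant,
  and the slack of the unit ball both bound a radius of admissible perturbations from below.
\<close>
lemma power_uniformly_convex_body:
  assumes p: "2 \<le> p" and e: "norm e = 1"
  shows "power_uniformly_convex_set p (body p e)"
proof -
  obtain c where c: "0 < c" and uniform:
    "\<And>x y \<eta>. \<lbrakk>x \<in> body p e; y \<in> body p e; \<eta> \<in> {0..1}\<rbrakk> \<Longrightarrow>
      excess p e (\<eta> *\<^sub>R x + (1 - \<eta>) *\<^sub>R y) \<le> - (\<eta> * (1 - \<eta>) * (c * norm (x - y) powr p))"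
    using excess_uniformly_convex[OF p e] by blast
  define K where "K = slope p 1 + 1"
  define \<alpha> where "\<alpha> = min (2 powr (1 - p)) (c / K)"
  have K: "0 < K" using slope_nonneg[of p 1] p by (simp add: K_def)
  have \<alpha>: "0 < \<alpha>" "\<alpha> \<le> 2 powr (1 - p)" "K * \<alpha> \<le> c"
    using c K by (auto simp: \<alpha>_def min_def field_simps)
  have "\<eta> *\<^sub>R x + (1 - \<eta>) *\<^sub>R y + (\<eta> * (1 - \<eta>) * (\<alpha> * norm (x - y) powr p)) *\<^sub>R z \<in> body p e"
    if x: "x \<in> body p e" and y: "y \<in> body p e" and \<eta>: "\<eta> \<in> {0..1}" and z: "norm z = 1" for x y z \<eta>
  proof -
    define D where "D = norm (x - y)"
    define m where "m = \<eta> *\<^sub>R x + (1 - \<eta>) *\<^sub>R y"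
    define \<rho> where "\<rho> = \<eta> * (1 - \<eta>) * (\<alpha> * D powr p)"
    have D: "0 \<le> D" "D \<le> 2"
      using norm_triangle_ineq4[of x y] x y by (auto simp: D_def body_def)
    have w: "0 \<le> \<eta> * (1 - \<eta>)" using \<eta> by simp
    have \<rho>0: "0 \<le> \<rho>" unfolding \<rho>_def using w \<alpha> by simp
    have "\<alpha> * D powr p \<le> D\<^sup>2 / 2"
    proof (cases "D = 0")
      case False
      then have D0: "0 < D" using D by simp
      have "\<alpha> * D powr p \<le> 2 powr (1 - p) * D powr p" using \<alpha> by (intro mult_right_mono) auto
      also have "\<dots> = 2 * (D / 2) powr p"
        using D by (simp add: powr_divide powr_diff)
      also have "\<dots> \<le> 2 * (D / 2) powr 2"
        using D D0 p by (intro mult_left_mono powr_mono') auto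
      also have "\<dots> = D\<^sup>2 / 2" using D0 by (simp add: power2_eq_square)
      finally show ?thesis .
    qed simp
    then have "\<rho> \<le> \<eta> * (1 - \<eta>) * (D\<^sup>2 / 2)" unfolding \<rho>_def using w by (intro mult_left_mono)
    moreover have "norm m \<le> 1 - \<eta> * (1 - \<eta>) * D\<^sup>2 / 2"
      unfolding m_def D_def using x y \<eta> by (intro norm_convex_combination_le) (auto simp: body_def)
    ultimately have m\<rho>: "norm m + \<rho> \<le> 1" by simp
    then have ball: "norm (m + \<rho> *\<^sub>R z) \<le> 1"
      using norm_triangle_ineq[of m "\<rho> *\<^sub>R z"] \<rho>0 z by simp
    have "excess p e (m + \<rho> *\<^sub>R z) \<le> excess p e m + K * \<rho>"
      using excess_lipschitz[of p e "m + \<rho> *\<^sub>R z" 1 m] ball m\<rho> \<rho>0 p e z by (simp add: K_def)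
    also have "\<dots> \<le> - (\<eta> * (1 - \<eta>) * (c * D powr p)) + \<eta> * (1 - \<eta>) * (c * D powr p)"
    proof (rule add_mono)
      show "excess p e m \<le> - (\<eta> * (1 - \<eta>) * (c * D powr p))"
        unfolding m_def D_def by (rule uniform[OF x y \<eta>])
      have "K * \<rho> = \<eta> * (1 - \<eta>) * (K * \<alpha> * D powr p)" by (simp add: \<rho>_def)
      also have "\<dots> \<le> \<eta> * (1 - \<eta>) * (c * D powr p)"
        using w \<alpha> by (intro mult_left_mono mult_right_mono) auto
      finally show "K * \<rho> \<le> \<eta> * (1 - \<eta>) * (c * D powr p)" .
    qed
    finally have "excess p e (m + \<rho> *\<^sub>R z) \<le> 0" by simp
    then show ?thesis using ball by (simp add: body_def m_def \<rho>_def D_def)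
  qed
  moreover have "mono_on {0..} (\<lambda>r. \<alpha> * r powr p)"
    using \<alpha> p by (intro mono_onI mult_left_mono powr_mono2) auto
  ultimately have "uniformly_convex_set (\<lambda>r. \<alpha> * r powr p) (body p e)"
    unfolding uniformly_convex_set_def using \<alpha> p closed_body[of p e] by auto
  then show ?thesis
    unfolding power_uniformly_convex_set_def using p \<alpha> by blast
qed

section \<open>Powers of the norm as objective\<close>

text \<open>
  This is the inverse of \<open>r \<mapsto> \<mu> * r powr \<theta>\<close> for \<open>k = 1 / \<theta>\<close>, applied to the distance from \<open>0\<close>, so the
  error bound with minimiser \<open>0\<close> is an equality.  Its sublevel sets are balls around \<open>0\<close>, so exact
  line search projects \<open>0\<close> onto a segment, whatever \<open>\<mu>\<close> and \<open>k\<close> are.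
\<close>
definition objective :: "real \<Rightarrow> real \<Rightarrow> 'a::real_normed_vector \<Rightarrow> real" where
  "objective \<mu> k x = (norm x / \<mu>) powr k"

lemma objective_eq: "0 < \<mu> \<Longrightarrow> objective \<mu> k x = norm x powr k / \<mu> powr k"
  by (simp add: objective_def powr_divide)

lemma continuous_on_objective:
  "\<lbrakk>0 < \<mu>; 0 < k\<rbrakk> \<Longrightarrow> continuous_on UNIV (objective \<mu> k)"
  unfolding objective_def by (intro continuous_on_powr' continuous_intros) auto

lemma objective_less_iff:
  "\<lbrakk>0 < \<mu>; 0 < k\<rbrakk> \<Longrightarrow> objective \<mu> k x < objective \<mu> k y \<longleftrightarrow> norm x < norm y"
  unfolding objective_def
  by (metis divide_less_cancel divide_nonneg_pos linorder_not_less norm_ge_zero order_less_asym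
      powr_less_mono2 powr_mono2 less_imp_le)

lemma GDERIV_objective:
  fixes x :: "'a::real_inner"
  assumes \<mu>: "0 < \<mu>" and k: "2 \<le> k"
  shows "GDERIV (objective \<mu> k) x :> (k / \<mu> powr k * norm x powr (k - 2)) *\<^sub>R x"
proof (cases "x = 0")
  case False
  have "GDERIV (\<lambda>x. norm x powr k / \<mu> powr k) x :> (k * norm x powr (k - 1) / \<mu> powr k) *\<^sub>R sgn x"
  proof (rule GDERIV_DERIV_compose[OF GDERIV_norm[OF False]])
    show "((\<lambda>r. r powr k / \<mu> powr k) has_real_derivative k * norm x powr (k - 1) / \<mu> powr k) (at (norm x))"
      using False \<mu> by (auto intro!: derivative_eq_intros)
  qed
  moreover have "(k * norm x powr (k - 1) / \<mu> powr k) *\<^sub>R sgn x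
      = (k / \<mu> powr k * norm x powr (k - 2)) *\<^sub>R x"
  proof -
    have "norm x powr (k - 1) = norm x powr (k - 2) * norm x"
      using False powr_add[of "norm x" "k - 2" 1] by simp
    then show ?thesis using False by (simp add: sgn_div_norm)
  qed
  moreover have "objective \<mu> k = (\<lambda>x::'a. norm x powr k / \<mu> powr k)"
    using \<mu> by (simp add: objective_eq fun_eq_iff)
  ultimately show ?thesis by simp
next
  case True
  have "((\<lambda>h::'a. norm h powr (k - 1) / \<mu> powr k) \<longlongrightarrow> norm (0::'a) powr (k - 1) / \<mu> powr k) (at 0)"
    using k \<mu> by (intro tendsto_divide tendsto_powr' tendsto_norm tendsto_ident_at tendsto_const) auto
  then have "((\<lambda>h::'a. norm h powr (k - 1) / \<mu> powr k) \<longlongrightarrow> 0) (at 0)" using k by simp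
  moreover have "\<forall>\<^sub>F h::'a in at 0. norm h powr (k - 1) / \<mu> powr k = norm (objective \<mu> k h) / norm h"
    using eventually_neq_at_within[of 0]
  proof eventually_elim
    case (elim h)
    then show ?case using \<mu> by (simp add: objective_eq powr_diff)
  qed
  ultimately have "((\<lambda>h::'a. norm (objective \<mu> k h) / norm h) \<longlongrightarrow> 0) (at 0)"
    by (rule Lim_transform_eventually)
  then have "(objective \<mu> k has_derivative (\<lambda>h::'a. 0)) (at 0)"
    by (simp add: has_derivative_at objective_def)
  then show ?thesis using True by (simp add: gderiv_def)
qed

text \<open>
  Two applications of the mean value theorem.  The derivative \<open>k * r powr (k - 1)\<close> is Lipschitz on the
  unit interval because \<open>k \<ge> 2\<close>.
\<close>
lemma powr_quadratic_upper_bound: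
  fixes r \<rho> k :: real
  assumes k: "2 \<le> k" and r: "0 \<le> r" "r \<le> 1" and \<rho>: "0 \<le> \<rho>" "\<rho> \<le> 1"
  shows "r powr k \<le> \<rho> powr k + k * \<rho> powr (k - 1) * (r - \<rho>) + k * (k - 1) * (r - \<rho>)\<^sup>2"
proof -
  have mvt: "\<exists>\<xi>. min a c \<le> \<xi> \<and> \<xi> \<le> max a c \<and> a powr q - c powr q = q * \<xi> powr (q - 1) * (a - c)"
    if "1 \<le> q" "0 \<le> a" "0 \<le> c" for a c q :: real
  proof -
    have ordered: "\<exists>\<xi>. c < \<xi> \<and> \<xi> < a \<and> a powr q - c powr q = q * \<xi> powr (q - 1) * (a - c)"
      if "c < a" "0 \<le> c" for a c
    proof -
      have "continuous_on {c..a} (\<lambda>x. x powr q)"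
        using that \<open>1 \<le> q\<close> by (intro continuous_on_powr' continuous_intros) auto
      moreover have "((\<lambda>x. x powr q) has_derivative (\<lambda>h. q * x powr (q - 1) * h)) (at x)" if "c < x" for x
        using has_real_derivative_powr[of x q] that \<open>0 \<le> c\<close> by (simp add: has_field_derivative_def)
      ultimately obtain \<xi> where "c < \<xi>" "\<xi> < a" "a powr q - c powr q = q * \<xi> powr (q - 1) * (a - c)"
        using mvt[OF \<open>c < a\<close>, of "\<lambda>x. x powr q" "\<lambda>x h. q * x powr (q - 1) * h"] by blast
      then show ?thesis by blast
    qed
    consider "a = c" | "c < a" | "a < c" by linarith
    then show ?thesis
    proof cases
      case 2
      from ordered[OF 2 \<open>0 \<le> c\<close>] obtain \<xi> where "c < \<xi>" "\<xi> < a"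
        "a powr q - c powr q = q * \<xi> powr (q - 1) * (a - c)" by blast
      then show ?thesis by (intro exI[of _ \<xi>]) auto
    next
      case 3
      from ordered[OF 3 \<open>0 \<le> a\<close>] obtain \<xi> where "a < \<xi>" "\<xi> < c"
        "c powr q - a powr q = q * \<xi> powr (q - 1) * (c - a)" by blast
      then show ?thesis by (intro exI[of _ \<xi>]) (auto simp: algebra_simps)
    qed auto
  qed
  obtain \<xi> where \<xi>: "min r \<rho> \<le> \<xi>" "\<xi> \<le> max r \<rho>" "r powr k - \<rho> powr k = k * \<xi> powr (k - 1) * (r - \<rho>)"
    using mvt[of k r \<rho>] k r \<rho> by auto
  have "0 \<le> \<xi>" using \<xi>(1) r \<rho> by linarith
  then obtain \<zeta> where \<zeta>: "min \<xi> \<rho> \<le> \<zeta>" "\<zeta> \<le> max \<xi> \<rho>"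
    "\<xi> powr (k - 1) - \<rho> powr (k - 1) = (k - 1) * \<zeta> powr (k - 1 - 1) * (\<xi> - \<rho>)"
    using mvt[of "k - 1" \<xi> \<rho>] k \<rho> by auto
  have "\<zeta> powr (k - 1 - 1) \<le> 1"
    using \<zeta> \<xi> r \<rho> k by (intro powr_le1) auto
  have "(\<xi> - \<rho>) * (r - \<rho>) \<le> (r - \<rho>)\<^sup>2" "0 \<le> (\<xi> - \<rho>) * (r - \<rho>)"
  proof -
    consider "\<rho> \<le> \<xi>" "\<xi> \<le> r" | "\<xi> \<le> \<rho>" "r \<le> \<xi>" using \<xi> by linarith
    then have "(\<xi> - \<rho>) * (r - \<rho>) \<le> (r - \<rho>)\<^sup>2 \<and> 0 \<le> (\<xi> - \<rho>) * (r - \<rho>)"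
      by cases (auto simp: power2_eq_square mult_right_mono mult_right_mono_neg
          mult_nonneg_nonneg mult_nonpos_nonpos)
    then show "(\<xi> - \<rho>) * (r - \<rho>) \<le> (r - \<rho>)\<^sup>2" "0 \<le> (\<xi> - \<rho>) * (r - \<rho>)" by auto
  qed
  then have "\<zeta> powr (k - 1 - 1) * ((\<xi> - \<rho>) * (r - \<rho>)) \<le> 1 * (r - \<rho>)\<^sup>2"
    using \<open>\<zeta> powr (k - 1 - 1) \<le> 1\<close> by (intro mult_mono) auto
  then have "k * (k - 1) * (\<zeta> powr (k - 1 - 1) * ((\<xi> - \<rho>) * (r - \<rho>))) \<le> k * (k - 1) * (r - \<rho>)\<^sup>2"
    using k by (intro mult_left_mono) auto
  moreover have "r powr k - \<rho> powr k - k * \<rho> powr (k - 1) * (r - \<rho>)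
      = k * (\<xi> powr (k - 1) - \<rho> powr (k - 1)) * (r - \<rho>)"
    unfolding \<xi>(3) by (simp add: algebra_simps)
  then have "r powr k - \<rho> powr k - k * \<rho> powr (k - 1) * (r - \<rho>)
      = k * (k - 1) * (\<zeta> powr (k - 1 - 1) * ((\<xi> - \<rho>) * (r - \<rho>)))"
    unfolding \<zeta>(3) by (simp only: mult_ac)
  ultimately show ?thesis by linarith
qed

text \<open>
  Only the norms \<open>r\<close>, \<open>\<rho>\<close> of the two points and their distance \<open>\<delta>\<close> enter, since
  \<open>y \<bullet> (x - y) = \<rho> * (r - \<rho>) + ((r - \<rho>)\<^sup>2 - \<delta>\<^sup>2) / 2\<close>.  This reduces the claim to the quadratic upper
  bound for powers on the unit interval, as \<open>\<bar>r - \<rho>\<bar> \<le> \<delta>\<close>.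
\<close>
lemma smooth_objective:
  fixes C :: "'a::real_inner set"
  assumes \<mu>: "0 < \<mu>" and k: "2 \<le> k" and C: "\<And>x. x \<in> C \<Longrightarrow> norm x \<le> 1"
  shows "smooth_fun_on C (objective \<mu> k)"
  unfolding smooth_fun_on_def
proof (intro conjI exI)
  show "open (UNIV :: 'a set)" "C \<subseteq> UNIV" by auto
  have "objective \<mu> k differentiable (at x)" for x :: 'a
    using GDERIV_objective[OF \<mu> k, of x] by (auto simp: gderiv_def differentiable_def)
  then show "objective \<mu> k differentiable_on (UNIV :: 'a set)"
    by (simp add: differentiable_on_def)
  define K where "K = k * (k - 1) + k / 2"
  define L where "L = 2 * (K / \<mu> powr k)"
  have L2: "L / 2 = K / \<mu> powr k"
    unfolding L_def by (rule nonzero_mult_div_cancel_left) simp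
  show "0 < L" using k \<mu> by (auto simp: L_def K_def intro!: divide_pos_pos add_nonneg_pos)
  show "\<forall>x\<in>C. \<forall>y\<in>C. objective \<mu> k x
      \<le> objective \<mu> k y + gradient (objective \<mu> k) y \<bullet> (x - y) + L / 2 * (norm (x - y))\<^sup>2"
  proof (intro ballI)
    fix x y assume "x \<in> C" "y \<in> C"
    define r \<rho> \<delta> where "r = norm x" and "\<rho> = norm y" and "\<delta> = norm (x - y)"
    have r: "0 \<le> r" "r \<le> 1" and \<rho>: "0 \<le> \<rho>" "\<rho> \<le> 1"
      using C \<open>x \<in> C\<close> \<open>y \<in> C\<close> by (auto simp: r_def \<rho>_def)
    have r\<rho>: "(r - \<rho>)\<^sup>2 \<le> \<delta>\<^sup>2"
      using norm_triangle_ineq3[of x y] by (simp add: r_def \<rho>_def \<delta>_def abs_le_square_iff[symmetric])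
    have split: "\<rho> powr (k - 1) = \<rho> powr (k - 2) * \<rho>"
      using powr_add[of \<rho> "k - 2" 1] \<rho> by (cases "\<rho> = 0") auto
    have inner: "y \<bullet> (x - y) = \<rho> * (r - \<rho>) + ((r - \<rho>)\<^sup>2 - \<delta>\<^sup>2) / 2"
    proof -
      have "\<delta>\<^sup>2 = r\<^sup>2 + \<rho>\<^sup>2 - 2 * (y \<bullet> x)" "y \<bullet> y = \<rho>\<^sup>2"
        unfolding \<delta>_def r_def \<rho>_def power2_norm_eq_inner by (simp_all add: inner_simps inner_commute)
      then show ?thesis by (simp add: inner_diff_right power2_eq_square field_simps)
    qed
    have "r powr k \<le> \<rho> powr k + k * \<rho> powr (k - 1) * (r - \<rho>) + k * (k - 1) * (r - \<rho>)\<^sup>2"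
      by (rule powr_quadratic_upper_bound[OF k r \<rho>])
    also have "\<dots> = \<rho> powr k + k * \<rho> powr (k - 2) * (y \<bullet> (x - y))
        + (k * (k - 1) * (r - \<rho>)\<^sup>2 + k / 2 * (\<rho> powr (k - 2) * (\<delta>\<^sup>2 - (r - \<rho>)\<^sup>2)))"
      unfolding inner split by (simp add: field_simps)
    also have "\<dots> \<le> \<rho> powr k + k * \<rho> powr (k - 2) * (y \<bullet> (x - y)) + (k * (k - 1) * \<delta>\<^sup>2 + k / 2 * (1 * \<delta>\<^sup>2))"
      using k r\<rho> \<rho> by (intro add_left_mono add_mono mult_left_mono mult_mono powr_le1) auto
    also have "\<dots> = \<rho> powr k + k * \<rho> powr (k - 2) * (y \<bullet> (x - y)) + K * \<delta>\<^sup>2"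
      by (simp add: K_def algebra_simps)
    finally have "r powr k / \<mu> powr k \<le> (\<rho> powr k + k * \<rho> powr (k - 2) * (y \<bullet> (x - y))
        + K * \<delta>\<^sup>2) / \<mu> powr k"
      by (intro divide_right_mono) auto
    then show "objective \<mu> k x
      \<le> objective \<mu> k y + gradient (objective \<mu> k) y \<bullet> (x - y) + L / 2 * (norm (x - y))\<^sup>2"
      unfolding gradient_eqI[OF GDERIV_objective[OF \<mu> k]] objective_eq[OF \<mu>] L2
      by (simp add: r_def \<rho>_def \<delta>_def add_divide_distrib mult_ac)
  qed
qed

text \<open>
  The squared norm is strictly convex, and the power \<open>k / 2 \<ge> 1\<close> is strictly increasing and convex.
\<close>
lemma strictly_convex_objective:
  fixes C :: "'a::real_inner set"
  assumes \<mu>: "0 < \<mu>" and k: "2 \<le> k" and C: "convex C"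
  shows "strictly_convex_on C (objective \<mu> k)"
  unfolding strictly_convex_on_def
proof (intro conjI ballI allI impI C)
  fix x y :: 'a and t :: real
  assume t: "x \<noteq> y \<and> 0 < t \<and> t < 1"
  let ?m = "(1 - t) *\<^sub>R x + t *\<^sub>R y"
  have "(norm ?m)\<^sup>2 = (1 - t) * (norm x)\<^sup>2 + t * (norm y)\<^sup>2 - t * (1 - t) * (norm (x - y))\<^sup>2"
    unfolding power2_norm_eq_inner by (simp add: inner_simps inner_commute algebra_simps)
  also have "\<dots> < (1 - t) * (norm x)\<^sup>2 + t * (norm y)\<^sup>2" using t by simp
  finally have "((norm ?m)\<^sup>2) powr (k / 2) < ((1 - t) * (norm x)\<^sup>2 + t * (norm y)\<^sup>2) powr (k / 2)"
    using k by (intro powr_less_mono2) auto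
  also have "\<dots> \<le> (1 - t) * ((norm x)\<^sup>2) powr (k / 2) + t * ((norm y)\<^sup>2) powr (k / 2)"
    using convex_onD[OF convex_on_powr[of "k / 2"], of t "(norm x)\<^sup>2" "(norm y)\<^sup>2"] k t by simp
  finally have "norm ?m powr k < (1 - t) * norm x powr k + t * norm y powr k"
    by (simp only: norm_powr_eq[symmetric])
  then have "norm ?m powr k / \<mu> powr k < ((1 - t) * norm x powr k + t * norm y powr k) / \<mu> powr k"
    using \<mu> by (intro divide_strict_right_mono) auto
  then show "objective \<mu> k ?m < (1 - t) * objective \<mu> k x + t * objective \<mu> k y"
    unfolding objective_eq[OF \<mu>] by (simp add: add_divide_distrib)
qed

lemma strictly_convex_on_imp_convex_on:
  assumes "strictly_convex_on C f"
  shows "convex_on C f"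
proof (rule convex_onI)
  show "convex C" using assms by (simp add: strictly_convex_on_def)
  fix t :: real and x y
  assume "0 < t" "t < 1" "x \<in> C" "y \<in> C"
  then show "f ((1 - t) *\<^sub>R x + t *\<^sub>R y) \<le> (1 - t) * f x + t * f y"
    using assms unfolding strictly_convex_on_def
    by (cases "x = y") (auto simp: less_imp_le algebra_simps simp flip: scaleR_add_left)
qed

lemma is_arg_min_objective: "\<lbrakk>0 \<in> C\<rbrakk> \<Longrightarrow> is_arg_min (objective \<mu> k) (\<lambda>x. x \<in> C) 0"
  by (auto simp: is_arg_min_linorder objective_def)

lemma hoelder_error_bound_objective:
  fixes C :: "'a::real_inner set"
  assumes "0 < \<mu>" "0 < \<theta>" "\<theta> \<le> 1 / 2" "convex C" "0 \<in> C"
  shows "hoelder_error_bound \<mu> \<theta> C (objective \<mu> (1 / \<theta>)) 0"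
proof -
  have "norm x \<le> \<mu> * (objective \<mu> (1 / \<theta>) x - objective \<mu> (1 / \<theta>) 0) powr \<theta>" for x :: 'a
    using assms by (simp add: objective_def powr_powr)
  then show ?thesis
    using assms strictly_convex_objective[of \<mu> "1 / \<theta>" C] is_arg_min_objective[of C \<mu> "1 / \<theta>"]
    by (auto simp: hoelder_error_bound_def field_simps)
qed

section \<open>Frank--Wolfe steps in the trap\<close>

lemma continuous_attains_arg_min:
  fixes f :: "'a::topological_space \<Rightarrow> real"
  assumes "compact S" "S \<noteq> {}" "continuous_on S f"
  shows "\<exists>x. is_arg_min f (\<lambda>x. x \<in> S) x"
  using continuous_attains_inf[OF assms] by (auto simp: is_arg_min_linorder)

lemma frank_wolfe_line_search_exists:
  fixes C :: "'a::real_inner set"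
  assumes C: "compact C" "C \<noteq> {}" and g: "continuous_on UNIV g"
  shows "\<exists>x. frank_wolfe_line_search C g x0 x"
proof -
  have "\<exists>y v s. is_arg_min (\<lambda>v. gradient g x \<bullet> v) (\<lambda>v. v \<in> C) v \<and>
      is_arg_min (\<lambda>s. g (x + s *\<^sub>R (v - x))) (\<lambda>s. s \<in> {0..1}) s \<and>
      y = x + s *\<^sub>R (v - x)" for x
  proof -
    have "continuous_on C (\<lambda>v. gradient g x \<bullet> v)" by (intro continuous_intros)
    then obtain v where v: "is_arg_min (\<lambda>v. gradient g x \<bullet> v) (\<lambda>v. v \<in> C) v"
      using continuous_attains_arg_min[OF C] by blast
    have "continuous_on {0..1} (\<lambda>s. g (x + s *\<^sub>R (v - x)))"
      by (rule continuous_on_compose2[OF g]) (auto intro!: continuous_intros)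
    then obtain s where "is_arg_min (\<lambda>s. g (x + s *\<^sub>R (v - x))) (\<lambda>s. s \<in> {0..1}) s"
      using continuous_attains_arg_min[of "{0..1::real}"] by auto
    with v show ?thesis by blast
  qed
  then obtain step where step: "\<And>x. \<exists>v s. is_arg_min (\<lambda>v. gradient g x \<bullet> v) (\<lambda>v. v \<in> C) v \<and>
      is_arg_min (\<lambda>s. g (x + s *\<^sub>R (v - x))) (\<lambda>s. s \<in> {0..1}) s \<and>
      step x = x + s *\<^sub>R (v - x)"
    by metis
  define x where "x t = (step ^^ t) x0" for t
  have "frank_wolfe_line_search C g x0 x"
    unfolding frank_wolfe_line_search_def x_def using step by simp
  then show ?thesis by blast
qed

lemma body_point_iff:
  assumes e: "e \<bullet> e = 1" "e' \<bullet> e' = 1" "e \<bullet> e' = 0"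
  shows "a *\<^sub>R e' + b *\<^sub>R e \<in> body p e \<longleftrightarrow> profile p \<bar>a\<bar> \<le> b \<and> a\<^sup>2 + b\<^sup>2 \<le> 1"
proof -
  have "horizontal e (a *\<^sub>R e' + b *\<^sub>R e) = a *\<^sub>R e'"
    using e by (simp add: horizontal_def inner_simps inner_commute)
  moreover have "norm e' = 1" using e by (simp add: norm_eq_1)
  moreover have "norm (a *\<^sub>R e' + b *\<^sub>R e) \<le> 1 \<longleftrightarrow> a\<^sup>2 + b\<^sup>2 \<le> 1"
    unfolding norm_eq_sqrt_inner real_sqrt_le_1_iff
    using e by (simp add: inner_simps inner_commute power2_eq_square)
  moreover have "(a *\<^sub>R e' + b *\<^sub>R e) \<bullet> e = b"
    using e by (simp add: inner_simps inner_commute)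
  ultimately show ?thesis by (simp add: body_def excess_def)
qed

text \<open>
  For \<open>v\<close> in the body with horizontal part \<open>W\<close>, the linear functional is at least a positive multiple of
  \<open>profile p (norm W) - s * norm W\<close>, with equality only for \<open>W\<close> antiparallel to the horizontal part of
  the iterate and \<open>v\<close> on the boundary.  Strict convexity of the profile forces \<open>norm W = u\<close>, where
  \<open>s = slope p u\<close>.
\<close>
lemma linear_minimizer_unique:
  fixes e e' :: "'a::real_inner"
  assumes p: "1 < p" and e: "e \<bullet> e = 1" "e' \<bullet> e' = 1" "e \<bullet> e' = 0"
    and \<epsilon>: "\<bar>\<epsilon>\<bar> = 1" and b: "0 < b" and u: "0 < u"
    and vertex: "(- \<epsilon> * u) *\<^sub>R e' + profile p u *\<^sub>R e \<in> body p e"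
    and c: "0 < c"
    and v: "is_arg_min (\<lambda>v. (c *\<^sub>R ((\<epsilon> * (slope p u * b)) *\<^sub>R e' + b *\<^sub>R e)) \<bullet> v) (\<lambda>v. v \<in> body p e) v"
  shows "v = (- \<epsilon> * u) *\<^sub>R e' + profile p u *\<^sub>R e"
proof -
  define W where "W = horizontal e v"
  define V where "V = v \<bullet> e"
  define s where "s = slope p u"
  have s: "0 < s" using slope_pos u p by (simp add: s_def)
  have \<epsilon>2: "\<epsilon> * \<epsilon> = 1" using \<epsilon> by (metis abs_mult_self mult_1)
  have v_eq: "v = W + V *\<^sub>R e" by (simp add: W_def V_def horizontal_def)
  have W_e: "e \<bullet> W = 0" using e by (simp add: W_def horizontal_def inner_simps inner_commute)
  have vb: "v \<in> body p e" using v by (simp add: is_arg_min_linorder)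
  have "profile p (norm W) \<le> V" using vb by (simp add: body_def excess_def W_def V_def)
  have value_v: "((\<epsilon> * (s * b)) *\<^sub>R e' + b *\<^sub>R e) \<bullet> v = b * (s * \<epsilon> * (e' \<bullet> W) + V)"
    unfolding v_eq using e W_e by (simp add: inner_simps inner_commute algebra_simps)
  have value_vertex: "((\<epsilon> * (s * b)) *\<^sub>R e' + b *\<^sub>R e) \<bullet> ((- \<epsilon> * u) *\<^sub>R e' + profile p u *\<^sub>R e)
      = b * (profile p u - s * u)"
    using e \<epsilon>2 by (simp add: inner_simps inner_commute algebra_simps)
  have "c * (((\<epsilon> * (s * b)) *\<^sub>R e' + b *\<^sub>R e) \<bullet> v) \<le> c * (b * (profile p u - s * u))"
    using v vertex unfolding is_arg_min_linorder s_def[symmetric]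
    by (simp only: inner_scaleR_left value_vertex[symmetric])
  then have le: "s * \<epsilon> * (e' \<bullet> W) + V \<le> profile p u - s * u"
    using c b by (simp add: value_v)
  have e'1: "norm e' = 1" using e by (simp add: norm_eq_1)
  have cs: "- norm W \<le> \<epsilon> * (e' \<bullet> W)"
    using Cauchy_Schwarz_ineq2[of e' W] e'1 \<epsilon> abs_mult[of \<epsilon> "e' \<bullet> W"] by simp
  have "s * (- norm W) \<le> s * (\<epsilon> * (e' \<bullet> W))"
    using cs s by (intro mult_left_mono) auto
  then have le2: "profile p (norm W) - s * norm W \<le> profile p u - s * u"
    using le \<open>profile p (norm W) \<le> V\<close> by (simp add: mult_ac)
  have nW: "norm W = u"
  proof (rule ccontr)
    assume "norm W \<noteq> u"
    then show False
      using profile_strict_tangent[OF p u, of "norm W"] le2 by (simp add: s_def algebra_simps)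
  qed
  then have "s * (\<epsilon> * (e' \<bullet> W)) \<le> s * (- u)"
    using le \<open>profile p (norm W) \<le> V\<close> by (simp add: mult_ac)
  then have "\<epsilon> * (e' \<bullet> W) \<le> - u" by (rule mult_left_le_imp_le) (rule s)
  with cs nW have dot: "\<epsilon> * (e' \<bullet> W) = - u" by simp
  then have V: "V = profile p u" using le \<open>profile p (norm W) \<le> V\<close> nW by (simp add: mult.assoc)
  have "(norm (W + (\<epsilon> * u) *\<^sub>R e'))\<^sup>2 = (norm W)\<^sup>2 + 2 * u * (\<epsilon> * (e' \<bullet> W)) + \<epsilon> * \<epsilon> * u\<^sup>2"
    unfolding power2_norm_eq_inner using e
    by (simp add: inner_simps inner_commute power2_eq_square algebra_simps)
  also have "\<dots> = 0" unfolding dot nW \<epsilon>2 by (simp add: power2_eq_square)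
  finally have "W = - ((\<epsilon> * u) *\<^sub>R e')" by (simp add: eq_neg_iff_add_eq_0)
  then show ?thesis using v_eq V by simp
qed

text \<open>
  By Pythagoras the foot \<open>y\<close> of the perpendicular from \<open>0\<close> is the only point of the line with minimal norm.
\<close>
lemma line_search_unique:
  fixes x v y :: "'a::real_inner"
  assumes \<mu>: "0 < \<mu>" "0 < k" and "x \<noteq> v" and \<gamma>: "0 \<le> \<gamma>" "\<gamma> \<le> 1"
    and y: "y = x + \<gamma> *\<^sub>R (v - x)" and orth: "y \<bullet> (v - x) = 0"
    and s: "is_arg_min (\<lambda>s. objective \<mu> k (x + s *\<^sub>R (v - x))) (\<lambda>s. s \<in> {0..1}) s"
  shows "s = \<gamma>"
proof (rule ccontr)
  assume "s \<noteq> \<gamma>"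
  have "x + s *\<^sub>R (v - x) = y + (s - \<gamma>) *\<^sub>R (v - x)" by (simp add: y algebra_simps)
  then have "(norm (x + s *\<^sub>R (v - x)))\<^sup>2 = (norm y)\<^sup>2 + (s - \<gamma>)\<^sup>2 * (norm (v - x))\<^sup>2"
    unfolding power2_norm_eq_inner using orth
    by (simp add: inner_add_left inner_add_right inner_commute power2_eq_square)
  moreover have "0 < (s - \<gamma>)\<^sup>2 * (norm (v - x))\<^sup>2" using \<open>s \<noteq> \<gamma>\<close> \<open>x \<noteq> v\<close> by simp
  ultimately have "(norm y)\<^sup>2 < (norm (x + s *\<^sub>R (v - x)))\<^sup>2" by simp
  then have "norm y < norm (x + s *\<^sub>R (v - x))" by (rule power2_less_imp_less) simp
  then have "objective \<mu> k (x + \<gamma> *\<^sub>R (v - x)) < objective \<mu> k (x + s *\<^sub>R (v - x))"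
    by (simp add: objective_less_iff[OF \<mu>] y)
  moreover have "objective \<mu> k (x + s *\<^sub>R (v - x)) \<le> objective \<mu> k (x + \<gamma> *\<^sub>R (v - x))"
    using s \<gamma> by (simp add: is_arg_min_linorder)
  ultimately show False by simp
qed

text \<open>
  An iterate with horizontal coordinate \<open>\<epsilon> * (s * b)\<close> and height \<open>b\<close> is answered by the vertex with
  horizontal coordinate \<open>- \<epsilon> * u\<close>, where \<open>slope p u = s\<close>.  The next iterate is the foot of the
  perpendicular from \<open>0\<close> onto the chord between them, so the ratio \<open>s'\<close> of its coordinates is the slope
  of the chord.  This is the recursion that preserves the trap.
\<close>
lemma frank_wolfe_step:
  fixes e e' :: "'a::real_inner"
  assumes p: "p \<ge> 3" and range: "trap_range p w0" and w: "0 < w" "w \<le> w0"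
    and trapped: "trapped p w s b"
    and e: "e \<bullet> e = 1" "e' \<bullet> e' = 1" "e \<bullet> e' = 0" and \<epsilon>: "\<bar>\<epsilon>\<bar> = 1"
    and \<mu>: "0 < \<mu>" and k: "2 \<le> k"
    and x: "x = (\<epsilon> * (s * b)) *\<^sub>R e' + b *\<^sub>R e"
    and v: "is_arg_min (\<lambda>v. gradient (objective \<mu> k) x \<bullet> v) (\<lambda>v. v \<in> body p e) v"
    and \<gamma>: "is_arg_min (\<lambda>s. objective \<mu> k (x + s *\<^sub>R (v - x))) (\<lambda>s. s \<in> {0..1}) \<gamma>"
  shows "\<exists>w' s' b'. 0 < w' \<and> w' \<le> w \<and> trapped p w' s' b' \<and>
    b' = b * (1 - s * s') / (1 + s'\<^sup>2) \<and>
    x + \<gamma> *\<^sub>R (v - x) = (- \<epsilon> * (s' * b')) *\<^sub>R e' + b' *\<^sub>R e"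
proof -
  have b: "b = level p w" "0 < b" using trapped level_pos[of p w] w p by (simp_all add: trapped_def)
  have lever: "slope p (2 * w) * b \<le> w ^ 3 * (w / 2)" and small: "2 * w + profile p (2 * w) + 2 * b \<le> 1"
    and half: "w \<le> 1 / 2"
    using range w unfolding trap_range_def trap_conditions_def b(1) by blast+
  have wlo: "w / 2 \<le> w * (1 - w)" and whi: "w * (1 + w) \<le> 2 * w" using w half by (simp_all add: field_simps)
  have "\<exists>u\<ge>w * (1 - w). u \<le> w * (1 + w) \<and> slope p u = s"
    using trapped w half p
    by (intro IVT' continuous_on_subset[OF continuous_on_slope]) (auto simp: trapped_def)
  then obtain u where u: "w * (1 - w) \<le> u" "u \<le> w * (1 + w)" "s = slope p u" by blast
  define s' where "s' = (b - profile p u) / (u + s * b)"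
  define b' where "b' = b * (1 - s * s') / (1 + s'\<^sup>2)"
  obtain w' where w': "0 < w'" "w' \<le> w" "trapped p w' s' b'"
    using trap_step[OF p range w trapped u s'_def b'_def] by blast
  have b': "0 < b'" using w' level_pos[of p w'] p by (simp add: trapped_def)
  have s: "0 < s" using u slope_pos[of p u] wlo w p by simp
  have u0: "0 < u" "w / 2 \<le> u" "u \<le> 2 * w" using u wlo whi w by linarith+
  have s'0: "0 \<le> s'" using w'(3) slope_nonneg[of p "w' * (1 - w')"] p by (simp add: trapped_def)
  have denom: "0 < u + s * b" using u0 s b by (intro add_pos_pos) auto
  have b'_le: "b' \<le> b"
  proof -
    have "b' * (1 + s'\<^sup>2) = b * (1 - s * s')"
      unfolding b'_def using zero_le_power2[of s'] by (simp add: add_nonneg_eq_0_iff)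
    also have "\<dots> \<le> b * 1" using b s s'0 by (intro mult_left_mono) auto
    finally have "b' * (1 + s'\<^sup>2) \<le> b" by simp
    moreover have "b' * 1 \<le> b' * (1 + s'\<^sup>2)" using b' by (intro mult_left_mono) auto
    ultimately show ?thesis by simp
  qed
  \<comment> \<open>the foot of the perpendicular does not pass the vertex, so the line search is not clipped at 1\<close>
  have s'b': "s' * b' \<le> u"
  proof -
    have "w' * (1 + w') \<le> 2 * w" using w' half by (intro mult_mono[of w' w, THEN order_trans]) auto
    then have "s' \<le> slope p (2 * w)"
      using w'(3) slope_mono[of p "w' * (1 + w')" "2 * w"] w' p by (simp add: trapped_def)
    then have "s' * b' \<le> slope p (2 * w) * b"
      using b' b'_le s'0 slope_nonneg[of p "2 * w"] p by (intro mult_mono) auto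
    also have "\<dots> \<le> w ^ 3 * (w / 2)" by (rule lever)
    also have "\<dots> \<le> 1 * (w / 2)" using w half by (intro mult_right_mono power_le_one) auto
    finally show ?thesis using u0 by simp
  qed
  define V where "V = (- \<epsilon> * u) *\<^sub>R e' + profile p u *\<^sub>R e"
  have "V \<in> body p e"
  proof -
    have "profile p u \<le> profile p (2 * w)" using u0 p by (intro profile_mono) auto
    then have le1: "u + profile p u \<le> 1" using small u0 b by linarith
    have "u\<^sup>2 + (profile p u)\<^sup>2 \<le> (u + profile p u)\<^sup>2"
      using u0 profile_nonneg[of p u] p by (simp add: power2_sum)
    also have "\<dots> \<le> 1" using le1 u0 profile_nonneg[of p u] p by (intro power_le_one) auto
    finally show ?thesis
      unfolding V_def using body_point_iff[OF e, of "- \<epsilon> * u" "profile p u" p] \<epsilon> u0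
      by (simp add: abs_mult power_mult_distrib flip: power2_abs[of \<epsilon>])
  qed
  have "x \<noteq> 0"
  proof
    assume "x = 0"
    then have "x \<bullet> e = 0" by simp
    then show False using b e by (simp add: x inner_simps inner_commute)
  qed
  then have c: "0 < k / \<mu> powr k * norm x powr (k - 2)" using k \<mu> by simp
  have v_eq: "v = V"
    unfolding V_def
  proof (rule linear_minimizer_unique[OF _ e \<epsilon> b(2) u0(1) _ c])
    show "(- \<epsilon> * u) *\<^sub>R e' + profile p u *\<^sub>R e \<in> body p e"
      using \<open>V \<in> body p e\<close> by (simp add: V_def)
    show "is_arg_min (\<lambda>v. ((k / \<mu> powr k * norm x powr (k - 2)) *\<^sub>R
        ((\<epsilon> * (slope p u * b)) *\<^sub>R e' + b *\<^sub>R e)) \<bullet> v) (\<lambda>v. v \<in> body p e) v"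
      using v unfolding gradient_eqI[OF GDERIV_objective[OF \<mu> k]] u(3)[symmetric] x[symmetric] .
  qed (use p in simp)
  \<comment> \<open>from comparing the horizontal coordinates of both sides of \<open>y = x + \<gamma>' *\<^sub>R (v - x)\<close>\<close>
  define \<gamma>' where "\<gamma>' = (s * b + s' * b') / (u + s * b)"
  define y where "y = (- \<epsilon> * (s' * b')) *\<^sub>R e' + b' *\<^sub>R e"
  have diff: "v - x = (- \<epsilon> * (u + s * b)) *\<^sub>R e' + (profile p u - b) *\<^sub>R e"
    unfolding v_eq V_def x by (simp add: algebra_simps)
  have slope_eq: "s' * (u + s * b) = b - profile p u" using denom by (simp add: s'_def)
  have \<gamma>'_eq: "\<gamma>' * (u + s * b) = s * b + s' * b'" using denom by (simp add: \<gamma>'_def)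
  have height: "b' * (1 + s'\<^sup>2) = b * (1 - s * s')"
    unfolding b'_def using zero_le_power2[of s'] by (simp add: add_nonneg_eq_0_iff)
  have y_eq: "y = x + \<gamma>' *\<^sub>R (v - x)"
  proof -
    have 1: "\<epsilon> * (s * b) + \<gamma>' * (- \<epsilon> * (u + s * b)) = - \<epsilon> * (s' * b')"
    proof -
      have "\<gamma>' * (- \<epsilon> * (u + s * b)) = - \<epsilon> * (\<gamma>' * (u + s * b))" by simp
      then show ?thesis unfolding \<gamma>'_eq by (simp add: algebra_simps)
    qed
    have 2: "b + \<gamma>' * (profile p u - b) = b'"
    proof -
      have "\<gamma>' * (profile p u - b) = - (\<gamma>' * (b - profile p u))" by (simp add: algebra_simps)
      also have "\<dots> = - s' * (\<gamma>' * (u + s * b))" unfolding slope_eq[symmetric] by simp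
      also have "\<dots> = - s' * (s * b + s' * b')" unfolding \<gamma>'_eq ..
      finally show ?thesis using height by (simp add: algebra_simps power2_eq_square)
    qed
    have "x + \<gamma>' *\<^sub>R (v - x) = (\<epsilon> * (s * b) + \<gamma>' * (- \<epsilon> * (u + s * b))) *\<^sub>R e'
        + (b + \<gamma>' * (profile p u - b)) *\<^sub>R e"
      unfolding diff unfolding x by (simp add: algebra_simps)
    then show ?thesis unfolding 1 2 y_def by simp
  qed
  have orth: "y \<bullet> (v - x) = 0"
  proof -
    have "y \<bullet> (v - x) = \<epsilon> * \<epsilon> * (s' * b') * (u + s * b) + b' * (profile p u - b)"
      unfolding y_def diff using e by (simp add: inner_simps inner_commute algebra_simps)
    also have "\<epsilon> * \<epsilon> = 1" using \<epsilon> by (metis abs_mult_self mult_1)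
    also have "1 * (s' * b') * (u + s * b) = b' * (s' * (u + s * b))" by simp
    also have "\<dots> + b' * (profile p u - b) = 0" unfolding slope_eq by (simp add: algebra_simps)
    finally show ?thesis .
  qed
  have "v - x \<noteq> 0"
  proof
    assume "v - x = 0"
    then have "(v - x) \<bullet> e' = 0" by simp
    then show False using denom \<epsilon> e unfolding diff by (auto simp: inner_simps inner_commute)
  qed
  moreover have "0 \<le> \<gamma>'" using s b s'0 b' denom by (simp add: \<gamma>'_def)
  moreover have "\<gamma>' \<le> 1" using s'b' denom by (simp add: \<gamma>'_def)
  ultimately have "\<gamma> = \<gamma>'"
    using line_search_unique[OF \<mu> _ _ _ _ y_eq orth \<gamma>] k by auto
  then have "x + \<gamma> *\<^sub>R (v - x) = y" using y_eq by simp
  then show ?thesis using w' b'_def y_def by blast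
qed

section \<open>The lower bound\<close>

text \<open>
  Every run started in the trap stays in the plane spanned by \<open>e\<close> and \<open>e'\<close> and in the trap, with the
  horizontal coordinate changing sign at each step.  Its norm is asymptotic to its height.
\<close>
lemma frank_wolfe_norm_rate:
  fixes e e' :: "'a::real_inner"
  assumes p: "p \<ge> 3" and range: "trap_range p w0" and w0: "0 < w0"
    and trapped: "trapped p w0 s0 b0"
    and e: "e \<bullet> e = 1" "e' \<bullet> e' = 1" "e \<bullet> e' = 0"
    and \<mu>: "0 < \<mu>" and k: "2 \<le> k"
    and fw: "frank_wolfe_line_search (body p e) (objective \<mu> k) ((s0 * b0) *\<^sub>R e' + b0 *\<^sub>R e) x"
  shows "0 < norm (x t)"
    and "(\<lambda>t. norm (x t) * real t powr (p / (2 * (p - 1))))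
      \<longlonglongrightarrow> (p + 1) / p * (p / (4 * (p - 1))) powr (p / (2 * (p - 1)))"
proof -
  define state where "state = (\<lambda>t (w, s, b). 0 < w \<and> w \<le> w0 \<and> trapped p w s b \<and>
    (\<exists>\<epsilon>. \<bar>\<epsilon>\<bar> = 1 \<and> x t = (\<epsilon> * (s * b)) *\<^sub>R e' + b *\<^sub>R e))"
  define height_step where "height_step = (\<lambda>(w::real, s::real, b::real) (w'::real, s'::real, b'::real).
    b' = b * (1 - s * s') / (1 + s'\<^sup>2))"
  have "\<exists>f. \<forall>t. state t (f t) \<and> height_step (f t) (f (Suc t))"
  proof (rule dependent_nat_choice)
    have "x 0 = (1 * (s0 * b0)) *\<^sub>R e' + b0 *\<^sub>R e"
      using fw by (simp add: frank_wolfe_line_search_def)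
    then have "state 0 (w0, s0, b0)" unfolding state_def using w0 trapped by force
    then show "\<exists>y. state 0 y" by blast
  next
    fix y t assume "state t y"
    then obtain w s b \<epsilon> where y: "y = (w, s, b)" and w: "0 < w" "w \<le> w0" and tr: "trapped p w s b"
      and \<epsilon>: "\<bar>\<epsilon>\<bar> = 1" and xt: "x t = (\<epsilon> * (s * b)) *\<^sub>R e' + b *\<^sub>R e"
      by (auto simp: state_def)
    obtain v \<gamma> where v: "is_arg_min (\<lambda>v. gradient (objective \<mu> k) (x t) \<bullet> v) (\<lambda>v. v \<in> body p e) v"
      and \<gamma>: "is_arg_min (\<lambda>s. objective \<mu> k (x t + s *\<^sub>R (v - x t))) (\<lambda>s. s \<in> {0..1}) \<gamma>"
      and next_x: "x (Suc t) = x t + \<gamma> *\<^sub>R (v - x t)"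
      using fw unfolding frank_wolfe_line_search_def by blast
    obtain w' s' b' where "0 < w'" "w' \<le> w" "trapped p w' s' b'"
      "b' = b * (1 - s * s') / (1 + s'\<^sup>2)"
      "x (Suc t) = (- \<epsilon> * (s' * b')) *\<^sub>R e' + b' *\<^sub>R e"
      using frank_wolfe_step[OF p range w tr e \<epsilon> \<mu> k xt v \<gamma>] unfolding next_x by blast
    then have "state (Suc t) (w', s', b') \<and> height_step y (w', s', b')"
      using w \<epsilon> unfolding state_def height_step_def y
      by (auto intro!: exI[of _ "- \<epsilon>"])
    then show "\<exists>z. state (Suc t) z \<and> height_step y z" by blast
  qed
  then obtain f where f: "\<And>t. state t (f t)" "\<And>t. height_step (f t) (f (Suc t))" by blast
  define w s b where "w = (\<lambda>t. fst (f t))" and "s = (\<lambda>t. fst (snd (f t)))" and "b = (\<lambda>t. snd (snd (f t)))"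
  have f_eq: "f t = (w t, s t, b t)" for t by (simp add: w_def s_def b_def)
  have w: "0 < w t" "w t \<le> w0" and tr: "trapped p (w t) (s t) (b t)"
    and x: "\<exists>\<epsilon>. \<bar>\<epsilon>\<bar> = 1 \<and> x t = (\<epsilon> * (s t * b t)) *\<^sub>R e' + b t *\<^sub>R e" for t
    using f(1)[of t] by (auto simp: state_def f_eq)
  have rec: "b (Suc t) = b t * (1 - s t * s (Suc t)) / (1 + (s (Suc t))\<^sup>2)" for t
    using f(2)[of t] by (simp add: height_step_def f_eq)
  have b: "0 < b t" for t using tr[of t] level_pos[of p "w t"] w p by (simp add: trapped_def)
  have norm_x: "norm (x t) = b t * sqrt (1 + (s t)\<^sup>2)" for t
  proof -
    obtain \<epsilon> where \<epsilon>: "\<bar>\<epsilon>\<bar> = 1" "x t = (\<epsilon> * (s t * b t)) *\<^sub>R e' + b t *\<^sub>R e" using x by blast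
    have "\<epsilon>\<^sup>2 = 1" using \<epsilon>(1) by (metis power2_abs one_power2)
    then have "x t \<bullet> x t = (b t)\<^sup>2 * (1 + (s t)\<^sup>2)"
      unfolding \<epsilon>(2) using e by (simp add: inner_simps inner_commute power2_eq_square algebra_simps)
    then show ?thesis using b[of t] by (simp add: norm_eq_sqrt_inner real_sqrt_mult)
  qed
  show "0 < norm (x t)" using b[of t] by (simp add: norm_x add_pos_nonneg)
  note rate = trapped_rate[where w = w and s = s and b = b, OF p range w tr rec]
  have "(\<lambda>t. b t * real t powr (p / (2 * (p - 1))) * sqrt (1 + (s t)\<^sup>2))
      \<longlonglongrightarrow> (p + 1) / p * (p / (4 * (p - 1))) powr (p / (2 * (p - 1))) * sqrt (1 + 0\<^sup>2)"
    by (intro tendsto_mult rate tendsto_real_sqrt tendsto_add tendsto_power tendsto_const)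
  then show "(\<lambda>t. norm (x t) * real t powr (p / (2 * (p - 1))))
      \<longlonglongrightarrow> (p + 1) / p * (p / (4 * (p - 1))) powr (p / (2 * (p - 1)))"
    by (simp add: norm_x mult_ac)
qed

lemma positive_limit_bounded_below:
  fixes a :: "nat \<Rightarrow> real"
  assumes lim: "a \<longlonglongrightarrow> K" and "0 < K" and pos: "\<And>t. 1 \<le> t \<Longrightarrow> 0 < a t"
  obtains c where "0 < c" "\<And>t. 1 \<le> t \<Longrightarrow> c \<le> a t"
proof -
  have "\<forall>\<^sub>F t in sequentially. K / 2 < a t"
    using \<open>0 < K\<close> by (intro order_tendstoD(1)[OF lim]) simp
  then obtain N where N: "\<And>t. N \<le> t \<Longrightarrow> K / 2 < a t"
    by (auto simp: eventually_sequentially)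
  define c where "c = Min (insert (K / 2) (a ` {1..N}))"
  have "0 < c" using \<open>0 < K\<close> pos by (simp add: c_def)
  moreover have "c \<le> a t" if "1 \<le> t" for t
  proof (cases "t \<le> N")
    case True
    then show ?thesis unfolding c_def using that by (intro Min_le) auto
  next
    case False
    have "c \<le> K / 2" unfolding c_def by (intro Min_le) auto
    then show ?thesis using N[of t] False by simp
  qed
  ultimately show ?thesis using that by blast
qed

lemma objective_rate_of_norm_rate:
  fixes x :: "nat \<Rightarrow> 'a::real_normed_vector"
  assumes \<mu>: "0 < \<mu>" and k: "0 < k" and K: "0 < K"
    and lim: "(\<lambda>t. norm (x t) * real t powr a) \<longlonglongrightarrow> K"
    and pos: "\<And>t. 0 < norm (x t)"
  shows "(\<lambda>t. objective \<mu> k (x t)) \<sim>[at_top] (\<lambda>t. \<mu> powr - k * K powr k * real t powr - (a * k))"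
    and "\<exists>c>0. \<forall>t\<ge>1. c * real t powr - (a * k) \<le> objective \<mu> k (x t)"
proof -
  define n where "n = (\<lambda>t. norm (x t) * real t powr a)"
  have obj: "objective \<mu> k (x t) = \<mu> powr - k * n t powr k * real t powr - (a * k)" if "1 \<le> t" for t
  proof -
    have "n t powr k = norm (x t) powr k * real t powr (a * k)"
      using that by (simp add: n_def powr_mult powr_powr)
    then show ?thesis using that \<mu> by (simp add: objective_eq powr_minus field_simps)
  qed
  have n_pos: "0 < n t" if "1 \<le> t" for t using that pos[of t] unfolding n_def by (intro mult_pos_pos) auto
  have "(\<lambda>t. (n t / K) powr k) \<longlonglongrightarrow> (K / K) powr k"
    unfolding n_def using K by (intro tendsto_powr tendsto_divide lim tendsto_const) auto
  then have ratio: "(\<lambda>t. (n t / K) powr k) \<longlonglongrightarrow> 1" using K by simp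
  have "\<forall>\<^sub>F t in at_top. (n t / K) powr k
      = objective \<mu> k (x t) / (\<mu> powr - k * K powr k * real t powr - (a * k))"
    using eventually_ge_at_top[of 1]
  proof eventually_elim
    case (elim t)
    have "(n t / K) powr k = n t powr k / K powr k"
      using K n_pos[OF elim] by (simp add: powr_divide)
    then show ?case using obj[OF elim] elim \<mu> by simp
  qed
  then show "(\<lambda>t. objective \<mu> k (x t)) \<sim>[at_top] (\<lambda>t. \<mu> powr - k * K powr k * real t powr - (a * k))"
    by (intro asymp_equivI' Lim_transform_eventually[OF ratio])
  obtain c where c: "0 < c" "\<And>t. 1 \<le> t \<Longrightarrow> c \<le> n t"
    using positive_limit_bounded_below[of n K] lim K n_pos unfolding n_def by blast
  have "\<mu> powr - k * c powr k * real t powr - (a * k) \<le> objective \<mu> k (x t)" if "1 \<le> t" for t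
    unfolding obj[OF that] using c that k
    by (intro mult_right_mono mult_left_mono powr_mono2) auto
  then show "\<exists>c>0. \<forall>t\<ge>1. c * real t powr - (a * k) \<le> objective \<mu> k (x t)"
    using c \<mu> by (intro exI[of _ "\<mu> powr - k * c powr k"]) auto
qed

theorem theorem5:
  fixes p \<mu> \<theta> :: real
  assumes "p \<ge> 3" and "CARD('d::finite) \<ge> 2" and "\<mu> > 0" and "0 < \<theta>" and "\<theta> \<le> 1/2"
  shows "\<exists>(C :: (real^'d) set) (g :: real^'d \<Rightarrow> real) xs x0.
    compact C \<and> convex C \<and> power_uniformly_convex_set p C \<and>
    smooth_fun_on C g \<and> convex_on C g \<and>
    is_arg_min g (\<lambda>x. x \<in> C) xs \<and> hoelder_error_bound \<mu> \<theta> C g xs \<and>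
    x0 \<in> C \<and>
    (\<exists>x. frank_wolfe_line_search C g x0 x) \<and>
    (\<forall>x. frank_wolfe_line_search C g x0 x \<longrightarrow>
      (\<lambda>T. g (x T) - g xs) \<sim>[at_top]
        (\<lambda>T. \<mu> powr (- (1 / \<theta>)) * ((p + 1) / p) powr (1 / \<theta>) *
             (p / (4 * (p - 1))) powr (p / (2 * \<theta> * (p - 1))) *
             real T powr (- (p / (2 * \<theta> * (p - 1))))) \<and>
      (\<exists>c>0. \<forall>T\<ge>1. g (x T) - g xs \<ge> c * real T powr (- (p / (2 * \<theta> * (p - 1))))))"
proof -
  note p = assms(1) and \<mu> = assms(3) and \<theta> = assms(4,5)
  obtain i j :: 'd where ij: "i \<noteq> j"
    using assms(2) card_le_Suc0_iff_eq[of "UNIV :: 'd set"] by (auto simp: not_less_eq_eq)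
  define e e' :: "real^'d" where "e = axis i 1" and "e' = axis j 1"
  have e: "e \<bullet> e = 1" "e' \<bullet> e' = 1" "e \<bullet> e' = 0"
    using ij by (auto simp: e_def e'_def inner_axis_axis)
  obtain w0 where range: "trap_range p w0" using trap_range_exists[OF p] .
  then have w0: "0 < w0" by (simp add: trap_range_def)
  define k s0 b0 where "k = 1 / \<theta>" and "s0 = slope p w0" and "b0 = level p w0"
  have k: "2 \<le> k" using \<theta> by (simp add: k_def field_simps)
  have half: "w0 \<le> 1 / 2" and lever: "slope p (2 * w0) * b0 \<le> w0 ^ 3 * (w0 / 2)"
    and small: "2 * w0 + profile p (2 * w0) + 2 * b0 \<le> 1"
    using range w0 unfolding trap_range_def trap_conditions_def b0_def by blast+
  have trapped: "trapped p w0 s0 b0"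
    unfolding trapped_def s0_def b0_def using w0 half p by (auto intro!: slope_mono)
  let ?C = "body p e" and ?g = "objective \<mu> k :: real^'d \<Rightarrow> real"
    and ?x0 = "(s0 * b0) *\<^sub>R e' + b0 *\<^sub>R e"
  have b0: "0 < b0" "profile p w0 \<le> b0"
    using level_pos[of p w0] w0 slope_nonneg[of p w0] p by (auto simp: b0_def level_def)
  have s0: "0 \<le> s0" using slope_nonneg[of p w0] p by (simp add: s0_def)
  have s0b0: "s0 * b0 \<le> w0"
  proof -
    have "s0 * b0 \<le> slope p (2 * w0) * b0"
      unfolding s0_def using w0 b0 p by (intro mult_right_mono slope_mono) auto
    also have "\<dots> \<le> w0 ^ 3 * (w0 / 2)" by (rule lever)
    also have "\<dots> \<le> 1 * (w0 / 2)" using w0 half by (intro mult_right_mono power_le_one) auto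
    finally show ?thesis using w0 by simp
  qed
  have x0: "?x0 \<in> ?C"
  proof -
    have "profile p (s0 * b0) \<le> b0"
      using profile_mono[of p "s0 * b0" w0] s0b0 s0 b0 p by simp
    moreover have "(s0 * b0)\<^sup>2 + b0\<^sup>2 \<le> (s0 * b0 + b0)\<^sup>2"
      using s0 b0 by (simp add: power2_sum)
    moreover have "(s0 * b0 + b0)\<^sup>2 \<le> 1"
    proof (rule power_le_one)
      show "s0 * b0 + b0 \<le> 1"
        using s0b0 small w0 b0 profile_nonneg[of p "2 * w0"] p by simp
    qed (use s0 b0 in simp)
    ultimately show ?thesis using body_point_iff[OF e, of "s0 * b0" b0 p] s0 b0 by simp
  qed
  have zero: "0 \<in> ?C"
    using body_point_iff[OF e, of 0 0 p] by simp
  have convex: "convex ?C" using p by (intro convex_body) simp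
  have norm_e: "norm e = 1" using e by (simp add: norm_eq_1)
  define a where "a = p / (2 * (p - 1))"
  define K where "K = (p + 1) / p * (p / (4 * (p - 1))) powr a"
  have K: "0 < K" using p by (simp add: K_def)
  have exponent: "a * k = p / (2 * \<theta> * (p - 1))" by (simp add: a_def k_def mult_ac)
  have const: "K powr k = ((p + 1) / p) powr (1 / \<theta>) * (p / (4 * (p - 1))) powr (p / (2 * \<theta> * (p - 1)))"
    unfolding K_def powr_mult powr_powr exponent by (simp only: k_def)
  have rate: "(\<lambda>T. ?g (x T) - ?g 0) \<sim>[at_top]
        (\<lambda>T. \<mu> powr (- (1 / \<theta>)) * ((p + 1) / p) powr (1 / \<theta>) *
             (p / (4 * (p - 1))) powr (p / (2 * \<theta> * (p - 1))) *
             real T powr (- (p / (2 * \<theta> * (p - 1))))) \<and>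
      (\<exists>c>0. \<forall>T\<ge>1. ?g (x T) - ?g 0 \<ge> c * real T powr (- (p / (2 * \<theta> * (p - 1)))))"
    if fw: "frank_wolfe_line_search ?C ?g ?x0 x" for x
  proof -
    note norms = frank_wolfe_norm_rate[OF p range w0 trapped e \<mu> k fw]
    have "0 < k" using k by simp
    note rates = objective_rate_of_norm_rate[OF \<mu> \<open>0 < k\<close> K norms(2)[folded a_def, folded K_def] norms(1)]
    have "?g 0 = 0" by (simp add: objective_def)
    with rates show ?thesis unfolding exponent const by (simp add: k_def mult.assoc)
  qed
  show ?thesis
  proof (rule exI[of _ ?C], rule exI[of _ ?g], rule exI[of _ 0], rule exI[of _ ?x0], intro conjI)
    show "compact ?C" using p by (intro compact_body) simp
    show "power_uniformly_convex_set p ?C" using p norm_e by (intro power_uniformly_convex_body) auto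
    show "smooth_fun_on ?C ?g" using \<mu> k by (intro smooth_objective) (auto simp: body_def)
    show "convex_on ?C ?g"
      by (intro strictly_convex_on_imp_convex_on strictly_convex_objective \<mu> k convex)
    show "is_arg_min ?g (\<lambda>x. x \<in> ?C) 0" using zero by (rule is_arg_min_objective)
    show "hoelder_error_bound \<mu> \<theta> ?C ?g 0"
      unfolding k_def by (intro hoelder_error_bound_objective \<mu> \<theta> convex zero)
    show "\<exists>x. frank_wolfe_line_search ?C ?g ?x0 x"
      using p \<mu> k zero by (intro frank_wolfe_line_search_exists compact_body continuous_on_objective) auto
  qed (use convex x0 rate in blast)+
qed

end
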